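(* For every $F\in\mathcal F$, the restriction of the pseudo-function $\mathrm{Pf}F$ to the space $\mathcal D$ of $C^\infty(\mathbb R^3)$ functions with compact support, i.e. the linear form $\varphi\in\mathcal D\mapsto\langle\mathrm{Pf}F,\varphi\rangle=\mathrm{Pf}_{s_1,s_2}\int d^3\mathbf x\,F\varphi$, is a distribution in the sense of Schwartz: $\mathrm{Pf}F|_{\mathcal D}\in\mathcal D'$.
   Context: Fix two distinct points $\mathbf y_1,\mathbf y_2\in\mathbb R^3$ and constants $s_1,s_2>0$. For $\mathbf x\in\mathbb R^3$ put $r_1=|\mathbf x-\mathbf y_1|$, $\mathbf n_1=(\mathbf x-\mathbf y_1)/r_1$, $r_2=|\mathbf x-\mathbf y_2|$, $\mathbf n_2=(\mathbf x-\mathbf y_2)/r_2$; $d\Omega_1$, $d\Omega_2$ are the solid angle elements of $\mathbf n_1$, $\mathbf n_2$. Class $\mathcal F$: real functions $F$, smooth on $\mathbb R^3\setminus\{\mathbf y_1,\mathbf y_2\}$, for which there are real exponents $a_0<a_1<a_2<\cdots$ (only finitely many below any bound) and functions ${}_1f_{a}$ on the unit sphere such that for all $N\in\mathbb N$, $F=\sum_{a\le N}r_1^{a}\,{}_1f_{a}(\mathbf n_1)+o(r_1^N)$ as $r_1\to0$ (uniformly in $\mathbf n_1$); and similarly at $\mathbf y_2$ with exponents $b$ and coefficients ${}_2f_b(\mathbf n_2)$. Put ${}_1f_a=0$ if $a$ is not one of the exponents (same for 2). One has $\mathcal D\subset\mathcal F$ and the product of two functions of $\mathcal F$ is in $\mathcal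 F$. Partie finie of an integral: with $\mathcal B_{1}(s),\mathcal B_2(s)$ the closed balls of radius $s$ centred at $\mathbf y_{1},\mathbf y_2$, for $F\in\mathcal F$ integrable near infinity, $$\mathrm{Pf}_{s_1,s_2}\int d^3\mathbf x\,F=\lim_{s\to0}\Bigl\{\int_{\mathbb R^3\setminus\mathcal B_1(s)\cup\mathcal B_2(s)}d^3\mathbf x\,F+\sum_{a+3<0}\frac{s^{a+3}}{a+3}\int d\Omega_1\,{}_1f_a+\ln\Bigl(\frac s{s_1}\Bigr)\int d\Omega_1\,{}_1f_{-3}+\sum_{b+3<0}\frac{s^{b+3}}{b+3}\int d\Omega_2\,{}_2f_b+\ln\Bigl(\frac s{s_2}\Bigr)\int d\Omega_2\,{}_2f_{-3}\Bigr\}.$$ The pseudo-function $\mathrm{Pf}F$ is the linear functional $G\mapsto\langle\mathrm{Pf}F,G\rangle=\mathrm{Pf}_{s_1,s_2}\int d^3\mathbf x\,FG$ on those $G\in\mathcal F$ for which $FG=o(|\mathbf x|^{-3})$ and the integral converges at infinity. *)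

theory Defs
  imports "HOL-Analysis.Analysis" "HOL-Library.Landau_Symbols"
begin

type_synonym point = "real ^ 3"

definition partial :: "3 \<Rightarrow> (point \<Rightarrow> real) \<Rightarrow> point \<Rightarrow> real" where
  "partial i f = (\<lambda>x. frechet_derivative f (at x) (axis i 1))"

text \<open>Iterated partial derivatives. A multi-index is represented by the list of the
  coordinate directions in which one differentiates successively.\<close>

primrec partials :: "3 list \<Rightarrow> (point \<Rightarrow> real) \<Rightarrow> point \<Rightarrow> real" where
  "partials [] f = f"
| "partials (i # is) f = partial i (partials is f)"

text \<open>\<open>C\<^sup>\<infinity>\<close> on \<open>S\<close>; meant for open \<open>S\<close>, where differentiability of all iterated partial
  derivatives also gives their continuity.\<close>

definition smooth_on :: "point set \<Rightarrow> (point \<Rightarrow> real) \<Rightarrow> bool" where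
  "smooth_on S f \<longleftrightarrow> (\<forall>is. \<forall>x\<in>S. partials is f differentiable (at x))"

text \<open>Expansion of \<open>F\<close> at \<open>y\<close> with exponents \<open>A\<close> and coefficients \<open>f a\<close>, of which only the values
  on the unit sphere matter. Here \<open>sgn (x - y)\<close> is the unit vector \<open>(x - y) / norm (x - y)\<close>, and
  the little-o along the filter \<open>at y\<close> is uniform in that direction.\<close>

definition has_expansion_at ::
  "point \<Rightarrow> (point \<Rightarrow> real) \<Rightarrow> real set \<Rightarrow> (real \<Rightarrow> point \<Rightarrow> real) \<Rightarrow> bool" where
  "has_expansion_at y F A f \<longleftrightarrow>
     (\<forall>c. finite {a \<in> A. a \<le> c}) \<and>
     (\<forall>a. a \<notin> A \<longrightarrow> (\<forall>n\<in>sphere 0 1. f a n = 0)) \<and>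
     (\<forall>N::nat. (\<lambda>x. F x - (\<Sum>a\<in>{a \<in> A. a \<le> real N}. norm (x - y) powr a * f a (sgn (x - y))))
        \<in> o[at y](\<lambda>x. norm (x - y) ^ N))"

text \<open>The values of a member at \<open>y1\<close> and \<open>y2\<close> themselves are arbitrary.\<close>

definition class_F :: "point \<Rightarrow> point \<Rightarrow> (point \<Rightarrow> real) set" where
  "class_F y1 y2 = {F. smooth_on (UNIV - {y1, y2}) F \<and>
     (\<exists>A f. has_expansion_at y1 F A f) \<and> (\<exists>B g. has_expansion_at y2 F B g)}"

text \<open>The coefficients are uniquely determined on the unit sphere by \<open>F\<close>, so the choice operator
  only leaves their values off the sphere unspecified.\<close>

definition coeff_at :: "point \<Rightarrow> (point \<Rightarrow> real) \<Rightarrow> real \<Rightarrow> point \<Rightarrow> real" where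
  "coeff_at y F = (SOME f. \<exists>A. has_expansion_at y F A f)"

text \<open>\<open>\<integral>d\<Omega> f\<close> with \<open>d\<Omega> = sin \<theta> d\<theta> d\<phi>\<close>.\<close>

definition solid_angle_integral :: "(point \<Rightarrow> real) \<Rightarrow> real" where
  "solid_angle_integral f =
     (LINT (\<theta>, \<phi>):{0..pi} \<times> {0..2*pi}|lborel.
        f (vector [sin \<theta> * cos \<phi>, sin \<theta> * sin \<phi>, cos \<theta>]) * sin \<theta>)"

text \<open>The sum runs over the exponents below \<open>-3\<close> whose coefficient does not vanish identically on
  the unit sphere; any other exponent would contribute zero.\<close>

definition counterterm :: "point \<Rightarrow> real \<Rightarrow> (point \<Rightarrow> real) \<Rightarrow> real \<Rightarrow> real" where
  "counterterm y s0 F s =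
     (\<Sum>a\<in>{a. a + 3 < 0 \<and> (\<exists>n\<in>sphere 0 1. coeff_at y F a n \<noteq> 0)}.
        s powr (a + 3) / (a + 3) * solid_angle_integral (coeff_at y F a)) +
     ln (s / s0) * solid_angle_integral (coeff_at y F (-3))"

definition pf_regularised ::
  "point \<Rightarrow> point \<Rightarrow> real \<Rightarrow> real \<Rightarrow> (point \<Rightarrow> real) \<Rightarrow> real \<Rightarrow> real" where
  "pf_regularised y1 y2 s1 s2 F s =
     (LINT x:UNIV - (cball y1 s \<union> cball y2 s)|lborel. F x) +
     counterterm y1 s1 F s + counterterm y2 s2 F s"

definition pf_integral ::
  "point \<Rightarrow> point \<Rightarrow> real \<Rightarrow> real \<Rightarrow> (point \<Rightarrow> real) \<Rightarrow> real" where
  "pf_integral y1 y2 s1 s2 F = Lim (at_right 0) (pf_regularised y1 y2 s1 s2 F)"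

text \<open>Integrals and limits being total in HOL, well-definedness of \<open>pf_integral\<close> is recorded
  separately.\<close>

definition pf_exists ::
  "point \<Rightarrow> point \<Rightarrow> real \<Rightarrow> real \<Rightarrow> (point \<Rightarrow> real) \<Rightarrow> bool" where
  "pf_exists y1 y2 s1 s2 F \<longleftrightarrow>
     F \<in> class_F y1 y2 \<and>
     (\<forall>s>0. set_integrable lborel (UNIV - (cball y1 s \<union> cball y2 s)) F) \<and>
     (\<exists>L. (pf_regularised y1 y2 s1 s2 F \<longlongrightarrow> L) (at_right 0))"

definition Pf ::
  "point \<Rightarrow> point \<Rightarrow> real \<Rightarrow> real \<Rightarrow> (point \<Rightarrow> real) \<Rightarrow> (point \<Rightarrow> real) \<Rightarrow> real" where
  "Pf y1 y2 s1 s2 F G = pf_integral y1 y2 s1 s2 (\<lambda>x. F x * G x)"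

definition Pf_domain :: "point \<Rightarrow> point \<Rightarrow> (point \<Rightarrow> real) \<Rightarrow> (point \<Rightarrow> real) set" where
  "Pf_domain y1 y2 F = {G \<in> class_F y1 y2.
     (\<lambda>x. F x * G x) \<in> o[at_infinity](\<lambda>x. norm x powr (-3)) \<and>
     (\<exists>R. set_integrable lborel (UNIV - cball 0 R) (\<lambda>x. F x * G x))}"

definition test_functions :: "(point \<Rightarrow> real) set" where
  "test_functions = {\<phi>. smooth_on UNIV \<phi> \<and> compact (closure {x. \<phi> x \<noteq> 0})}"

text \<open>Membership of a form in \<open>\<D>'\<close>: linearity on test functions, and continuity on the test
  functions supported in each fixed compact set, whose topology is given by the seminorms
  \<open>sup \<bar>\<partial>\<^sup>\<alpha> \<phi>\<bar>\<close>. Lists that are permutations of each other give the same derivative, which only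
  changes the constant \<open>C\<close>.\<close>

definition distribution :: "((point \<Rightarrow> real) \<Rightarrow> real) \<Rightarrow> bool" where
  "distribution T \<longleftrightarrow>
     (\<forall>\<phi>\<in>test_functions. \<forall>\<psi>\<in>test_functions. T (\<lambda>x. \<phi> x + \<psi> x) = T \<phi> + T \<psi>) \<and>
     (\<forall>c. \<forall>\<phi>\<in>test_functions. T (\<lambda>x. c * \<phi> x) = c * T \<phi>) \<and>
     (\<forall>K. compact K \<longrightarrow> (\<exists>C m. \<forall>\<phi>\<in>test_functions. closure {x. \<phi> x \<noteq> 0} \<subseteq> K \<longrightarrow>
        \<bar>T \<phi>\<bar> \<le> C * (\<Sum>is\<in>{is. length is \<le> m}. SUP x. \<bar>partials is \<phi> x\<bar>)))"

end

theory Submission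
  imports Defs
begin

text \<open>
  Near a singular point \<open>y\<close> the function \<open>F\<close> is, up to a bounded remainder, a finite sum of terms
  \<open>r\<^sup>a f\<^sub>a(n)\<close>. Evaluating \<open>F\<close> on the dilated spheres of radii \<open>r, r/2, r/4, \<dots>\<close> and interpolating
  expresses each \<open>f\<^sub>a\<close> as a uniform limit of combinations of values of \<open>F\<close>, which gives at once
  continuity and uniqueness of the coefficients and their vanishing for \<open>a < 0\<close> if \<open>F\<close> is bounded. In
  polar coordinates each term integrates over \<open>s < r \<le> d\<close> to an explicit power of \<open>s\<close> or a logarithm
  that the counterterm cancels, so the limit defining the finite part exists; it splits into an
  ordinary integral away from the singular points and one local finite part at each of them.

  For the continuity estimate choose \<open>p\<close> with \<open>\<bar>F\<bar> \<le> C r\<^sup>-\<^sup>p\<close> near \<open>y\<close> and subtract from \<open>\<phi>\<close> its Taylor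
  polynomial of degree below \<open>p\<close>. The product of \<open>F\<close> with the Taylor remainder is bounded by the
  derivatives of order \<open>p\<close> and has no counterterm, while the polynomial part contributes finitely many
  derivatives of \<open>\<phi>\<close> at \<open>y\<close>, multiplied by the finite parts of \<open>F\<close> times fixed monomials.
\<close>

section \<open>Spherical coordinates\<close>

text \<open>Membership in \<open>class_F\<close> only postulates that coefficients exist as
  functions on the sphere. Neither continuity nor measurability is given, yet integrating them and
  multiplying two expansions requires integrability and boundedness. Continuity has to be extracted
  from F itself, and the uniformity of the little-o in the direction is what makes this possible.
  The dilation ratio 1/2 serves to turn distinct exponents into distinct interpolation nodes.

  Integrals and limits are total functions, so an identity between finite parts is available only
  after integrability and convergence are known. Linearity is therefore proved for the regularised
  expression at fixed \<open>s\<close> and then passes to the limit. For this the counterterm,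
  defined through a choice of coefficients, must be computable from any expansion; that is the use
  of uniqueness.\<close>

definition spherical :: "point \<Rightarrow> point \<Rightarrow> point" where
  "spherical y p = y + p $ 1 *\<^sub>R vector [sin (p $ 2) * cos (p $ 3), sin (p $ 2) * sin (p $ 3), cos (p $ 2)]"

text \<open>In this form the rules for sums and scalar multiples yield continuity and
  derivatives.\<close>

lemma vector_eq_sum_axis: "(vector [a, b, c] :: point) = a *\<^sub>R axis 1 1 + b *\<^sub>R axis 2 1 + c *\<^sub>R axis 3 1"
  by (simp add: vec_eq_iff forall_3 axis_def)

lemma continuous_on_vector3 [continuous_intros]:
  assumes "continuous_on S a" "continuous_on S b" "continuous_on S c"
  shows "continuous_on S (\<lambda>x. vector [a x, b x, c x] :: point)"
  unfolding vector_eq_sum_axis by (intro continuous_intros assms)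

lemma norm_vec3: "norm (x :: point) = sqrt ((x $ 1)\<^sup>2 + (x $ 2)\<^sup>2 + (x $ 3)\<^sup>2)"
  by (simp add: norm_eq_sqrt_inner inner_vec_def sum_3 power2_eq_square)

lemma norm_direction: "norm (vector [sin \<theta> * cos \<phi>, sin \<theta> * sin \<phi>, cos \<theta>] :: point) = 1"
proof -
  have "(sin \<theta> * cos \<phi>)\<^sup>2 + (sin \<theta> * sin \<phi>)\<^sup>2 + (cos \<theta>)\<^sup>2
      = (sin \<theta>)\<^sup>2 * ((sin \<phi>)\<^sup>2 + (cos \<phi>)\<^sup>2) + (cos \<theta>)\<^sup>2"
    by (simp only: power_mult_distrib) algebra
  also have "\<dots> = 1" by simp
  finally show ?thesis by (simp add: norm_vec3)
qed

lemma norm_spherical: "p $ 1 > 0 \<Longrightarrow> norm (spherical y p - y) = p $ 1"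
  by (simp add: spherical_def norm_direction)

lemma sgn_spherical:
  "p $ 1 > 0 \<Longrightarrow> sgn (spherical y p - y) = vector [sin (p $ 2) * cos (p $ 3), sin (p $ 2) * sin (p $ 3), cos (p $ 2)]"
  by (simp add: spherical_def sgn_div_norm norm_direction)

lemma has_derivative_spherical:
  "(spherical y has_derivative (\<lambda>h. h $ 1 *\<^sub>R vector [sin ((p::point) $ 2) * cos (p $ 3), sin (p $ 2) * sin (p $ 3), cos (p $ 2)]
      + p $ 1 *\<^sub>R vector [h $ 2 * cos (p $ 2) * cos (p $ 3) - h $ 3 * sin (p $ 2) * sin (p $ 3),
          h $ 2 * cos (p $ 2) * sin (p $ 3) + h $ 3 * sin (p $ 2) * cos (p $ 3), - (h $ 2 * sin (p $ 2))])) (at p within S)"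
proof -
  note [derivative_intros] = bounded_linear.has_derivative[OF bounded_linear_vec_nth]
  show ?thesis
    unfolding spherical_def vector_eq_sum_axis
    by (rule derivative_eq_intros refl)+ (simp add: fun_eq_iff vec_eq_iff forall_3 axis_def algebra_simps)
qed

lemma det_spherical:
  "det (matrix (\<lambda>h::point. h $ 1 *\<^sub>R vector [sin ((p::point) $ 2) * cos (p $ 3), sin (p $ 2) * sin (p $ 3), cos (p $ 2)]
      + p $ 1 *\<^sub>R vector [h $ 2 * cos (p $ 2) * cos (p $ 3) - h $ 3 * sin (p $ 2) * sin (p $ 3),
          h $ 2 * cos (p $ 2) * sin (p $ 3) + h $ 3 * sin (p $ 2) * cos (p $ 3), - (h $ 2 * sin (p $ 2))]))
   = (p $ 1)\<^sup>2 * sin (p $ 2)"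
proof -
  \<comment> \<open>With sine and cosine abstracted to reals subject to two Pythagorean identities,
    the determinant is a polynomial, and its terms factor through both identities.\<close>
  have "det (matrix (\<lambda>h::point. h $ 1 *\<^sub>R vector [s * C, s * S, c]
      + r *\<^sub>R vector [h $ 2 * c * C - h $ 3 * s * S, h $ 2 * c * S + h $ 3 * s * C, - (h $ 2 * s)])) = r\<^sup>2 * s"
    if "s\<^sup>2 + c\<^sup>2 = 1" "S\<^sup>2 + C\<^sup>2 = 1" for r s c S C :: real
  proof -
    have "r * (c * C) * (r * (s * C)) * c + r * (s * S) * (s * S) * (r * s) + s * C * (r * (s * C)) * (r * s)
        + r * (s * S) * (r * (c * S)) * c = r\<^sup>2 * s * ((s\<^sup>2 + c\<^sup>2) * (S\<^sup>2 + C\<^sup>2))"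
      by (simp add: power2_eq_square algebra_simps)
    with that show ?thesis
      unfolding det_3 matrix_def by (simp add: axis_def)
  qed
  then show ?thesis by simp
qed

text \<open>The norm determines the radius, the cosine is injective on the range of the polar angle,
  and the sine of that angle is positive, so it cancels and leaves the azimuth. The strict bounds
  exclude the poles and the identification of 0 with a full turn.\<close>

lemma inj_on_spherical: "inj_on (spherical y) {p. p $ 1 > 0 \<and> 0 < p $ 2 \<and> (p::point) $ 2 < pi \<and> 0 < p $ 3 \<and> p $ 3 < 2 * pi}"
proof (rule inj_onI, clarify)
  fix p q :: point
  assume eq: "spherical y p = spherical y q"
    and p: "p $ 1 > 0" "0 < p $ 2" "p $ 2 < pi" "0 < p $ 3" "p $ 3 < 2 * pi"
    and q: "q $ 1 > 0" "0 < q $ 2" "q $ 2 < pi" "0 < q $ 3" "q $ 3 < 2 * pi"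
  have 1: "p $ 1 = q $ 1" using norm_spherical[OF p(1)] norm_spherical[OF q(1)] eq by metis
  have v: "vector [sin (p $ 2) * cos (p $ 3), sin (p $ 2) * sin (p $ 3), cos (p $ 2)]
      = (vector [sin (q $ 2) * cos (q $ 3), sin (q $ 2) * sin (q $ 3), cos (q $ 2)] :: point)"
    using sgn_spherical[OF p(1)] sgn_spherical[OF q(1)] eq by metis
  have v3: "cos (p $ 2) = cos (q $ 2)" using arg_cong[OF v, of "\<lambda>v. v $ 3"] by simp
  have 2: "p $ 2 = q $ 2" using p q by (intro cos_inj_pi[OF _ _ _ _ v3]) linarith+
  have "sin (p $ 2) > 0" using p by (intro sin_gt_zero) auto
  then have "sin (p $ 3) = sin (q $ 3)" "cos (p $ 3) = cos (q $ 3)"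
    using arg_cong[OF v, of "\<lambda>v. v $ 1"] arg_cong[OF v, of "\<lambda>v. v $ 2"] by (simp_all add: 2)
  then obtain n :: int where n: "p $ 3 = q $ 3 + 2 * pi * n"
    using sin_cos_eq_iff by metis
  have "\<bar>2 * pi * n\<bar> < 2 * pi" using n p q by linarith
  then have "\<bar>real_of_int n\<bar> < 1" by (simp add: abs_mult)
  then have "n = 0" by linarith
  then have 3: "p $ 3 = q $ 3" using n by simp
  show "p = q" using 1 2 3 by (simp add: vec_eq_iff forall_3)
qed

text \<open>The open parameter ranges miss the axis and the half plane of azimuth 0. Both lie in the
  plane excluded by the hypothesis, which is negligible and easier to describe than the half
  plane.\<close>

lemma spherical_surj:
  fixes x y :: point
  assumes "x $ 2 \<noteq> y $ 2"
  shows "\<exists>p. spherical y p = x \<and> p $ 1 = norm (x - y) \<and> 0 < p $ 2 \<and> p $ 2 < pi \<and> 0 < p $ 3 \<and> p $ 3 < 2 * pi"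
proof -
  define r where "r = norm (x - y)"
  define n where "n = (1 / r) *\<^sub>R (x - y)"
  have r: "r > 0" using assms by (auto simp: r_def)
  have "norm n = 1" using r by (simp add: n_def r_def)
  then have nn: "(n $ 1)\<^sup>2 + (n $ 2)\<^sup>2 + (n $ 3)\<^sup>2 = 1" by (simp add: norm_vec3)
  have n2: "n $ 2 \<noteq> 0" using assms r by (simp add: n_def)
  have x: "x = y + r *\<^sub>R n" using r by (simp add: n_def)
  have "(n $ 2)\<^sup>2 > 0" using n2 by simp
  then have "(n $ 3)\<^sup>2 < 1" using nn sum_power2_ge_zero[of "n $ 1" 0] by (smt (verit) zero_le_power2)
  then have n3: "\<bar>n $ 3\<bar> < 1" by (simp add: abs_square_less_1)
  define \<theta> where "\<theta> = arccos (n $ 3)"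
  have \<theta>: "0 < \<theta>" "\<theta> < pi" "cos \<theta> = n $ 3"
    using n3 arccos_lt_bounded[of "n $ 3"] by (auto simp: \<theta>_def)
  then have s: "sin \<theta> > 0" by (intro sin_gt_zero) auto
  have s2: "(sin \<theta>)\<^sup>2 = (n $ 1)\<^sup>2 + (n $ 2)\<^sup>2" using nn \<theta>(3) by (simp add: sin_squared_eq)
  have "(n $ 1 / sin \<theta>)\<^sup>2 + (n $ 2 / sin \<theta>)\<^sup>2 = 1"
    using s s2 by (simp add: power_divide add_divide_distrib[symmetric] flip: s2)
  then obtain t where t: "0 \<le> t" "t < 2 * pi" "n $ 1 / sin \<theta> = cos t" "n $ 2 / sin \<theta> = sin t"
    by (rule sincos_total_2pi)
  have "t \<noteq> 0" using t(4) n2 s by auto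
  with t have t0: "0 < t" by simp
  have n': "n = vector [sin \<theta> * cos t, sin \<theta> * sin t, cos \<theta>]"
    using s \<theta>(3) by (simp add: vec_eq_iff forall_3 flip: t(3,4))
  show ?thesis
    using r \<open>norm n = 1\<close> by (intro exI[of _ "vector [r, \<theta>, t]"]) (simp add: spherical_def \<theta> t t0 r_def[symmetric] x n'[unfolded \<theta>(3), symmetric])
qed

text \<open>The change of variables takes place in \<open>point\<close>, whereas
  \<open>solid_angle_integral\<close> and Fubini's theorem refer to products of \<open>real\<close>.
  Lebesgue measure is determined by its values on boxes, and on these both measures give the product
  of the three side lengths.\<close>

lemma distr_vector3: "distr lborel borel (\<lambda>(r, \<theta>, \<phi>). vector [r, \<theta>, \<phi>]) = (lborel :: point measure)"
  (is "distr _ _ ?T = _")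
proof (rule lborel_eqI[symmetric])
  have cont: "continuous_on UNIV ?T"
    unfolding split_def by (intro continuous_intros)
  then have meas: "?T \<in> lborel \<rightarrow>\<^sub>M borel"
    by (simp add: borel_measurable_continuous_onI)
  fix l u :: point
  assume lu: "\<And>b. b \<in> Basis \<Longrightarrow> l \<bullet> b \<le> u \<bullet> b"
  have lu': "l $ i \<le> u $ i" for i using lu[of "axis i 1"] by (simp add: cart_eq_inner_axis axis_in_Basis_iff)
  have "?T -` box l u = {l $ 1<..<u $ 1} \<times> {l $ 2<..<u $ 2} \<times> {l $ 3<..<u $ 3}"
    by (auto simp: mem_box_cart forall_3)
  then have "emeasure (distr lborel borel ?T) (box l u)
      = emeasure (lborel \<Otimes>\<^sub>M lborel \<Otimes>\<^sub>M lborel) ({l $ 1<..<u $ 1} \<times> {l $ 2<..<u $ 2} \<times> {l $ 3<..<u $ 3})"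
    by (subst emeasure_distr[OF meas]) (auto simp: lborel_prod)
  also have "\<dots> = ennreal ((u $ 1 - l $ 1) * ((u $ 2 - l $ 2) * (u $ 3 - l $ 3)))"
  proof -
    have "emeasure (lborel \<Otimes>\<^sub>M lborel) ({l $ 2<..<u $ 2} \<times> {l $ 3<..<u $ 3}) = ennreal (u $ 2 - l $ 2) * ennreal (u $ 3 - l $ 3)"
      by (subst lborel.emeasure_pair_measure_Times) (simp_all add: lu')
    then show ?thesis
      unfolding lborel_prod
      by (subst lborel_prod[symmetric], subst lborel.emeasure_pair_measure_Times)
        (simp_all add: lu' ennreal_mult'' borel_Times)
  qed
  also have "\<dots> = (\<Prod>b\<in>Basis. (u - l) \<bullet> b)"
  proof -
    have B: "(Basis :: point set) = range (\<lambda>i. axis i 1)"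
      by (auto simp: Basis_vec_def)
    have "(\<Prod>b\<in>(Basis::point set). (u - l) \<bullet> b) = (\<Prod>i\<in>UNIV. (u - l) $ i)"
      unfolding B by (subst prod.reindex) (auto simp: inj_on_def axis_eq_axis inner_axis)
    also have "\<dots> = (u - l) $ 1 * ((u - l) $ 2 * (u - l) $ 3)"
      unfolding UNIV_3 by (simp add: ac_simps)
    finally show ?thesis by simp
  qed
  finally show "emeasure (distr lborel borel ?T) (box l u) = (\<Prod>b\<in>Basis. (u - l) \<bullet> b)" .
qed simp

section \<open>Integration over annuli in polar coordinates\<close>

lemma continuous_on_radial_angular:
  assumes "0 < s" "continuous_on {s..d} h" "continuous_on (sphere 0 1) f"
  shows "continuous_on {x::point. s \<le> norm (x - y) \<and> norm (x - y) \<le> d} (\<lambda>x. h (norm (x - y)) * f (sgn (x - y)) :: real)"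
proof (intro continuous_on_mult)
  show "continuous_on {x. s \<le> norm (x - y) \<and> norm (x - y) \<le> d} (\<lambda>x. h (norm (x - y)))"
    by (rule continuous_on_compose2[OF assms(2)]) (auto intro!: continuous_intros)
  show "continuous_on {x. s \<le> norm (x - y) \<and> norm (x - y) \<le> d} (\<lambda>x. f (sgn (x - y)))"
    by (rule continuous_on_compose2[OF assms(3)])
      (use assms(1) in \<open>auto intro!: continuous_intros simp: norm_sgn\<close>)
qed

text \<open>Fubini's theorem for a radial factor times an angular one. The angular integral stays a
  Lebesgue integral over pairs, since that is the form of
  \<open>solid_angle_integral\<close>.\<close>

lemma set_integral_spherical_box:
  fixes u :: "real \<Rightarrow> real" and v :: "real \<times> real \<Rightarrow> real"
  assumes u: "continuous_on {a..b} u" and v: "continuous_on ({c..d} \<times> {e..g}) v"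
  shows "integral (cbox (vector [a, c, e]) (vector [b, d, g])) (\<lambda>p::point. u (p $ 1) * v (p $ 2, p $ 3))
    = integral {a..b} u * (LINT q:{c..d} \<times> {e..g}|lborel. v q)"
proof -
  let ?D = "cbox (vector [a, c, e]) (vector [b, d, g]) :: point set"
  let ?H = "\<lambda>p::point. u (p $ 1) * v (p $ 2, p $ 3)"
  let ?T = "\<lambda>(r, \<theta>, \<phi>). vector [r, \<theta>, \<phi>] :: point"
  let ?U = "\<lambda>r. indicator {a..b} r *\<^sub>R u r" and ?V = "\<lambda>q. indicator ({c..d} \<times> {e..g}) q *\<^sub>R v q"
  have "continuous_on ?D ?H"
    by (intro continuous_intros continuous_on_compose2[OF u] continuous_on_compose2[OF v])
      (auto simp: mem_box_cart forall_3)
  then have int: "integrable lborel (\<lambda>p. indicator ?D p *\<^sub>R ?H p)"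
    by (intro borel_integrable_compact) auto
  have meas: "?T \<in> lborel \<rightarrow>\<^sub>M borel"
    using borel_measurable_continuous_onI[of ?T] unfolding split_def by (simp add: continuous_intros)
  have eq: "indicator ?D (?T q) *\<^sub>R ?H (?T q) = ?U (fst q) * ?V (snd q)" for q
    by (auto simp: mem_box_cart forall_3 indicator_def split: prod.splits)
  have "integral ?D ?H = (LINT p|lborel. indicator ?D p *\<^sub>R ?H p)"
    using int set_borel_integral_eq_integral(2)[of ?D ?H] by (simp add: set_integrable_def set_lebesgue_integral_def)
  also have "\<dots> = (LINT q|lborel. indicator ?D (?T q) *\<^sub>R ?H (?T q))"
    by (subst distr_vector3[symmetric], rule integral_distr[OF meas]) (use int in auto)
  also have "\<dots> = (LINT q|(lborel \<Otimes>\<^sub>M lborel). ?U (fst q) * ?V (snd q))"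
    unfolding eq lborel_prod ..
  also have "\<dots> = (LINT r|lborel. (LINT q|lborel. ?U r * ?V q))"
  proof (subst lborel_pair.integral_fst'[symmetric])
    \<comment> \<open>Integrability over the product is inherited from \<open>point\<close>, where
      it holds by continuity on the compact box.\<close>
    have "integrable (distr lborel borel ?T) (\<lambda>p. indicator ?D p *\<^sub>R ?H p)"
      using int unfolding distr_vector3 .
    from integrable_distr[OF meas this] show "integrable (lborel \<Otimes>\<^sub>M lborel) (\<lambda>q. ?U (fst q) * ?V (snd q))"
      unfolding eq lborel_prod .
  qed simp
  also have "\<dots> = (LINT r|lborel. ?U r) * (LINT q|lborel. ?V q)"
    by simp
  also have "(LINT r|lborel. ?U r) = integral {a..b} u"
    using set_borel_integral_eq_integral(2)[of "{a..b}" u] borel_integrable_atLeastAtMost'[OF u]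
    by (simp add: set_lebesgue_integral_def)
  finally show ?thesis by (simp add: set_lebesgue_integral_def)
qed

text \<open>The map is injective on the open box, as the change of variables requires, with Jacobian
  \<open>r^2 sin \<theta>\<close>; the closed box is compact, which gives integrability and Fubini.
  The two boxes differ by a null set.\<close>

lemma polar_integral:
  assumes s: "0 < s" and h: "continuous_on {s..d} h" and f: "continuous_on (sphere 0 1) f"
  shows "(LINT x:cball y d - cball y s|lborel. h (norm (x - y)) * f (sgn (x - y)))
    = integral {s..d} (\<lambda>r. r\<^sup>2 * h r) * solid_angle_integral f"
proof -
  let ?G = "\<lambda>x. h (norm (x - y)) * f (sgn (x - y))"
  let ?n = "\<lambda>q. vector [sin (fst q) * cos (snd q), sin (fst q) * sin (snd q), cos (fst q)] :: point"
  let ?u = "\<lambda>r. r\<^sup>2 * h r" and ?v = "\<lambda>q. f (?n q) * sin (fst q)"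
  let ?H = "\<lambda>p::point. ?u (p $ 1) * ?v (p $ 2, p $ 3)"
  let ?a = "vector [s, 0, 0] :: point" and ?b = "vector [d, pi, 2 * pi] :: point"
  have A: "{x. s \<le> norm (x - y) \<and> norm (x - y) \<le> d} = cball y d - ball y s"
    by (auto simp: dist_norm norm_minus_commute)
  have "integrable lborel (\<lambda>x. indicator (cball y d - ball y s) x *\<^sub>R ?G x)"
    using continuous_on_radial_angular[OF s h f, of y] unfolding A
    by (intro borel_integrable_compact) (auto simp: compact_diff)
  then have "set_integrable lborel (cball y d - ball y s) ?G"
    by (simp add: set_integrable_def)
  then have "set_integrable lborel (cball y d - cball y s) ?G"
    by (rule set_integrable_subset) auto
  then have "(LINT x:cball y d - cball y s|lborel. ?G x) = integral (cball y d - cball y s) ?G"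
    by (rule set_borel_integral_eq_integral)
  also have "\<dots> = integral (spherical y ` box ?a ?b) ?G"
  proof (rule integral_spike_set)
    \<comment> \<open>The inner sphere is already removed from the annulus, so a point that is not
      reached has radius exactly \<open>d\<close> or lies in the plane avoided by
      \<open>spherical_surj\<close>.\<close>
    have "cball y d - cball y s - spherical y ` box ?a ?b \<subseteq> sphere y d \<union> {x. x $ 2 = y $ 2}"
    proof (rule subsetI, rule UnCI)
      fix x assume "x \<in> cball y d - cball y s - spherical y ` box ?a ?b" "x \<notin> {x. x $ 2 = y $ 2}"
      then have x: "x \<in> cball y d" "x \<notin> cball y s" "x $ 2 \<noteq> y $ 2" "x \<notin> spherical y ` box ?a ?b" by auto
      from spherical_surj[OF x(3)] obtain p where
        p: "spherical y p = x" "p $ 1 = norm (x - y)" "0 < p $ 2" "p $ 2 < pi" "0 < p $ 3" "p $ 3 < 2 * pi" by blast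
      then have "p \<notin> box ?a ?b" using x by blast
      then show "x \<in> sphere y d"
        using p x by (auto simp: mem_box_cart forall_3 dist_norm norm_minus_commute)
    qed
    moreover have "negligible (sphere y d \<union> {x. x $ 2 = y $ 2})"
      using negligible_hyperplane[of "axis 2 1 :: point" "y $ 2"]
      by (auto simp: negligible_sphere negligible_Un inner_axis' axis_eq_0_iff)
    ultimately show "negligible {x \<in> cball y d - cball y s - spherical y ` box ?a ?b. ?G x \<noteq> 0}"
      by - (rule negligible_subset[OF negligible_subset], assumption, assumption, blast)
    have "spherical y ` box ?a ?b \<subseteq> cball y d - cball y s"
    proof clarify
      fix p assume "p \<in> box ?a ?b"
      then have "s < p $ 1" "p $ 1 < d" by (auto simp: mem_box_cart forall_3)
      then show "spherical y p \<in> cball y d - cball y s"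
        using norm_spherical[of p y] s by (auto simp: dist_norm norm_minus_commute)
    qed
    then have "{x \<in> spherical y ` box ?a ?b - (cball y d - cball y s). ?G x \<noteq> 0} = {}" by blast
    then show "negligible {x \<in> spherical y ` box ?a ?b - (cball y d - cball y s). ?G x \<noteq> 0}" 
      by (simp only: negligible_empty)
  qed
  also have "\<dots> = integral (box ?a ?b) ?H"
  proof -
    have cv: "continuous_on ({0..pi} \<times> {0..2*pi}) ?v"
      by (intro continuous_intros continuous_on_compose2[OF f]) (auto simp: norm_direction)
    have "continuous_on (cbox ?a ?b) ?H"
      by (intro continuous_intros continuous_on_compose2[OF h] continuous_on_compose2[OF cv])
        (auto simp: mem_box_cart forall_3)
    then have "?H absolutely_integrable_on cbox ?a ?b"
      by (rule absolutely_integrable_continuous)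
    then have H: "?H absolutely_integrable_on box ?a ?b"
      by (rule set_integrable_subset) (auto simp: box_subset_cbox)
    define g' :: "point \<Rightarrow> point \<Rightarrow> point" where "g' p h = h $ 1 *\<^sub>R vector [sin (p $ 2) * cos (p $ 3), sin (p $ 2) * sin (p $ 3), cos (p $ 2)]
      + p $ 1 *\<^sub>R vector [h $ 2 * cos (p $ 2) * cos (p $ 3) - h $ 3 * sin (p $ 2) * sin (p $ 3),
          h $ 2 * cos (p $ 2) * sin (p $ 3) + h $ 3 * sin (p $ 2) * cos (p $ 3), - (h $ 2 * sin (p $ 2))]" for p h
    have der: "(spherical y has_derivative g' p) (at p within S)" for p S
      unfolding g'_def by (rule has_derivative_spherical)
    have inj: "inj_on (spherical y) (box ?a ?b)"
      by (rule inj_on_subset[OF inj_on_spherical]) (use s in \<open>auto simp: mem_box_cart forall_3\<close>)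
    have eq: "\<bar>det (matrix (g' p))\<bar> * ?G (spherical y p) = ?H p" if "p \<in> box ?a ?b" for p
    proof -
      have p: "s < p $ 1" "p $ 1 < d" "0 < p $ 2" "p $ 2 < pi" using that by (auto simp: mem_box_cart forall_3)
      then have "sin (p $ 2) > 0" by (intro sin_gt_zero)
      then show ?thesis
        using p s unfolding g'_def det_spherical by (simp add: norm_spherical sgn_spherical abs_mult)
    qed
    (* The library theorem is stated for vector-valued integrands only, hence the detour through
       \<open>real ^ 1\<close>. *)
    let ?F = "\<lambda>x. vec (?G x) :: real ^ 1"
    have H1: "(\<lambda>p. \<bar>det (matrix (g' p))\<bar> * ?G (spherical y p)) absolutely_integrable_on box ?a ?b"
      using H by (rule set_integrable_cong[THEN iffD1, rotated -1]) (auto simp: eq)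
    have "(\<lambda>p. \<bar>det (matrix (g' p))\<bar> *\<^sub>R ?F (spherical y p)) absolutely_integrable_on box ?a ?b \<and>
       integral (box ?a ?b) (\<lambda>p. \<bar>det (matrix (g' p))\<bar> *\<^sub>R ?F (spherical y p)) = vec (integral (box ?a ?b) (\<lambda>p. \<bar>det (matrix (g' p))\<bar> * ?G (spherical y p)))
     \<longleftrightarrow> ?F absolutely_integrable_on (spherical y ` box ?a ?b) \<and> integral (spherical y ` box ?a ?b) ?F = vec (integral (box ?a ?b) (\<lambda>p. \<bar>det (matrix (g' p))\<bar> * ?G (spherical y p)))"
      by (rule has_absolute_integral_change_of_variables[OF _ der inj]) auto
    then have "integral (spherical y ` box ?a ?b) ?G = integral (box ?a ?b) (\<lambda>p. \<bar>det (matrix (g' p))\<bar> * ?G (spherical y p))"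
      using H1 by (simp add: absolutely_integrable_on_1_iff integral_on_1_eq)
    also have "\<dots> = integral (box ?a ?b) ?H"
      by (rule integral_cong) (rule eq)
    finally show ?thesis .
  qed
  also have "\<dots> = integral (cbox ?a ?b) ?H"
    by (rule integral_open_interval)
  also have "\<dots> = integral {s..d} ?u * (LINT q:{0..pi} \<times> {0..2*pi}|lborel. ?v q)"
    by (intro set_integral_spherical_box continuous_intros h continuous_on_compose2[OF f]) (auto simp: norm_direction)
  also have "(LINT q:{0..pi} \<times> {0..2*pi}|lborel. ?v q) = solid_angle_integral f"
    by (simp add: solid_angle_integral_def split_def)
  finally show ?thesis .
qed

section \<open>Coefficients of expansions\<close>

text \<open>Lagrange interpolation at the nodes \<open>2\<^sup>-\<^sup>a\<close>, \<open>a \<in> S\<close>.\<close>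

lemma exponent_interpolation:
  fixes S :: "real set"
  assumes "finite S" "b \<in> S"
  obtains c :: "nat \<Rightarrow> real" and k where
    "\<And>f r. r > 0 \<Longrightarrow> (\<Sum>i\<le>k. c i * (\<Sum>a\<in>S. ((1/2) ^ i * r) powr a * f a)) = r powr b * f b"
proof
  define q :: "real \<Rightarrow> real" where "q a = (1/2) powr a" for a
  define p where "p = (\<Prod>a\<in>S - {b}. smult (1 / (q b - q a)) [:- q a, 1:])"
  \<comment> \<open>Distinct exponents give distinct nodes, so the denominators of the Lagrange
    polynomial do not vanish.\<close>
  have inj: "q a = q a' \<longleftrightarrow> a = a'" for a a'
    by (auto simp: q_def powr_def)
  have p: "poly p (q a) = (if a = b then 1 else 0)" if "a \<in> S" for a
  proof (cases "a = b")
    case True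
    then show ?thesis by (auto simp: p_def poly_prod inj diff_divide_distrib[symmetric] intro!: prod.neutral)
  next
    case False
    then show ?thesis
      using that assms by (auto simp: p_def poly_prod intro!: prod_zero bexI[of _ a])
  qed
  fix f :: "real \<Rightarrow> real" and r :: real
  assume r: "r > 0"
  \<comment> \<open>Halving the radius \<open>i\<close> times multiplies the term of exponent
    \<open>a\<close> by \<open>q a ^ i\<close>. Weighting by the coefficients of \<open>p\<close>
    therefore evaluates \<open>p\<close> at the nodes, where it singles out
    \<open>b\<close>.\<close>
  have pw: "((1/2) ^ i * r) powr a = q a ^ i * r powr a" for i a
    using r by (simp add: q_def powr_mult powr_realpow[symmetric] powr_powr mult.commute)
  have "(\<Sum>i\<le>degree p. coeff p i * (\<Sum>a\<in>S. ((1/2) ^ i * r) powr a * f a))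
      = (\<Sum>a\<in>S. poly p (q a) * (r powr a * f a))"
    unfolding pw poly_altdef sum_distrib_left sum_distrib_right
    by (subst sum.swap) (simp add: mult_ac)
  also have "\<dots> = (\<Sum>a\<in>S. if a = b then r powr b * f b else 0)"
    by (intro sum.cong) (auto simp: p)
  also have "\<dots> = r powr b * f b"
    using assms by simp
  finally show "(\<Sum>i\<le>degree p. coeff p i * (\<Sum>a\<in>S. ((1/2) ^ i * r) powr a * f a)) = r powr b * f b" .
qed

text \<open>Interpolation compares values of F at several radii in one direction, so the remainder
  bound is recast as a condition on the radius alone, valid for all directions at once.\<close>

lemma expansion_remainder:
  assumes "has_expansion_at y F A f" "\<epsilon> > 0"
  shows "\<forall>\<^sub>F r in at_right 0. \<forall>n\<in>sphere 0 1.
    \<bar>F (y + r *\<^sub>R n) - (\<Sum>a\<in>{a \<in> A. a \<le> real N}. r powr a * f a n)\<bar> \<le> \<epsilon> * r ^ N"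
proof -
  have "\<forall>\<^sub>F x in at y. norm (F x - (\<Sum>a\<in>{a \<in> A. a \<le> real N}. norm (x - y) powr a * f a (sgn (x - y))))
      \<le> \<epsilon> * norm (norm (x - y) ^ N)"
    using assms by (intro landau_o.smallD) (auto simp: has_expansion_at_def)
  then obtain d where "d > 0" and d: "\<And>x. x \<noteq> y \<Longrightarrow> dist x y < d \<Longrightarrow>
      norm (F x - (\<Sum>a\<in>{a \<in> A. a \<le> real N}. norm (x - y) powr a * f a (sgn (x - y)))) \<le> \<epsilon> * norm (norm (x - y) ^ N)"
    unfolding eventually_at by blast
  have "\<forall>\<^sub>F r in at_right 0. 0 < r \<and> r < d"
    using \<open>d > 0\<close> by (auto simp: eventually_at_right intro!: exI[of _ d])
  then show ?thesis
  proof eventually_elim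
    case (elim r)
    show ?case
    proof
      fix n :: point assume "n \<in> sphere 0 1"
      then have n: "norm n = 1" by simp
      then have "n \<noteq> 0" by auto
      then show "\<bar>F (y + r *\<^sub>R n) - (\<Sum>a\<in>{a \<in> A. a \<le> real N}. r powr a * f a n)\<bar> \<le> \<epsilon> * r ^ N"
        using d[of "y + r *\<^sub>R n"] elim n by (simp add: dist_norm sgn_div_norm)
    qed
  qed
qed

text \<open>Halving only decreases the radius, so one threshold serves all the interpolation
  nodes.\<close>

lemma eventually_at_right_scaled:
  assumes "\<forall>\<^sub>F r in at_right (0::real). P r"
  shows "\<forall>\<^sub>F r in at_right 0. \<forall>i::nat. P ((1/2) ^ i * r)"
proof -
  obtain d where "d > 0" and d: "\<And>r. 0 < r \<Longrightarrow> r < d \<Longrightarrow> P r"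
    using assms unfolding eventually_at_right_field by auto
  have "P ((1/2) ^ i * r)" if "0 < r" "r < d" for r i
  proof (rule d)
    have "(1/2) ^ i * r \<le> 1 * r" using that by (intro mult_right_mono power_le_one) auto
    then show "(1/2) ^ i * r < d" using that by linarith
  qed (use that in simp)
  then show ?thesis
    using \<open>d > 0\<close> unfolding eventually_at_right_field by blast
qed

text \<open>The weights remove every other exponent up to \<open>N\<close> exactly, so the remainder
  is the only error; as \<open>N \<ge> a\<close>, it is still small after division by
  \<open>r powr a\<close>. Its bound is the same in all directions, hence the uniform limit.\<close>

lemma expansion_coeff_limit:
  assumes exp: "has_expansion_at y F A f" and a: "a \<in> A"
  obtains c :: "nat \<Rightarrow> real" and k where
    "uniform_limit (sphere 0 1) (\<lambda>r n. r powr (- a) * (\<Sum>i\<le>k. c i * F (y + ((1/2) ^ i * r) *\<^sub>R n))) (f a) (at_right 0)"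
proof -
  obtain N :: nat where N: "a \<le> real N" using real_arch_simple by blast
  define S where "S = {a \<in> A. a \<le> real N}"
  have "finite S" "a \<in> S" using exp a N by (auto simp: S_def has_expansion_at_def)
  then obtain c :: "nat \<Rightarrow> real" and k where c:
    "\<And>f r. r > 0 \<Longrightarrow> (\<Sum>i\<le>k. c i * (\<Sum>a\<in>S. ((1/2) ^ i * r) powr a * f a)) = r powr a * f a"
    by (rule exponent_interpolation) blast
  define C where "C = (\<Sum>i\<le>k. \<bar>c i\<bar>)"
  have C: "C \<ge> 0" by (simp add: C_def sum_nonneg)
  have "uniform_limit (sphere 0 1) (\<lambda>r n. r powr (- a) * (\<Sum>i\<le>k. c i * F (y + ((1/2) ^ i * r) *\<^sub>R n))) (f a) (at_right 0)"
  proof (rule uniform_limitI)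
    fix e :: real assume e: "e > 0"
    \<comment> \<open>\<open>C\<close> is the total weight by which remainders can be amplified;
      adding 1 keeps the quotient defined and the final inequality strict.\<close>
    define \<epsilon> where "\<epsilon> = e / (C + 1)"
    have \<epsilon>: "\<epsilon> > 0" using e C by (simp add: \<epsilon>_def)
    have "C * \<epsilon> < e" using e C by (simp add: \<epsilon>_def field_simps)
    have 1: "\<forall>\<^sub>F r in at_right (0::real). 0 < r \<and> r < 1"
      by (auto simp: eventually_at_right_field intro!: exI[of _ 1])
    from eventually_at_right_scaled[OF expansion_remainder[OF exp \<epsilon>, of N]] 1
    show "\<forall>\<^sub>F r in at_right 0. \<forall>n\<in>sphere 0 1. dist (r powr (- a) * (\<Sum>i\<le>k. c i * F (y + ((1/2) ^ i * r) *\<^sub>R n))) (f a n) < e"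
    proof eventually_elim
      case (elim r)
      show ?case
      proof
        fix n :: point assume n: "n \<in> sphere 0 1"
        let ?R = "\<lambda>i. F (y + ((1/2) ^ i * r) *\<^sub>R n) - (\<Sum>a\<in>S. ((1/2) ^ i * r) powr a * f a n)"
        have R: "\<bar>?R i\<bar> \<le> \<epsilon> * r powr a" for i
        proof -
          have "\<bar>?R i\<bar> \<le> \<epsilon> * ((1/2) ^ i * r) ^ N" using elim n by (simp add: S_def)
          also have "\<dots> \<le> \<epsilon> * (1 * r) ^ N"
            using elim \<epsilon> by (intro mult_left_mono power_mono mult_right_mono power_le_one) auto
          also have "\<dots> = \<epsilon> * r powr (real N)" using elim by (simp add: powr_realpow)
          \<comment> \<open>Here \<open>r < 1\<close> is needed: the larger exponent gives the
            smaller power.\<close>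
          also have "\<dots> \<le> \<epsilon> * r powr a"
            using elim \<epsilon> N by (intro mult_left_mono powr_mono') auto
          finally show ?thesis .
        qed
        have "f a n = r powr (- a) * (r powr a * f a n)"
          using elim by (simp add: powr_minus)
        also have "\<dots> = r powr (- a) * (\<Sum>i\<le>k. c i * (\<Sum>a\<in>S. ((1/2) ^ i * r) powr a * f a n))"
          using c[of r "\<lambda>a. f a n"] elim by simp
        finally have "r powr (- a) * (\<Sum>i\<le>k. c i * F (y + ((1/2) ^ i * r) *\<^sub>R n)) - f a n
            = r powr (- a) * (\<Sum>i\<le>k. c i * ?R i)"
          by (simp add: right_diff_distrib sum_subtractf)
        moreover have "\<bar>\<Sum>i\<le>k. c i * ?R i\<bar> \<le> (\<Sum>i\<le>k. \<bar>c i\<bar> * (\<epsilon> * r powr a))"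
          unfolding abs_mult by (intro order_trans[OF sum_abs] sum_mono) (simp add: abs_mult R mult_left_mono)
        then have "r powr (- a) * \<bar>\<Sum>i\<le>k. c i * ?R i\<bar> \<le> r powr (- a) * (C * (\<epsilon> * r powr a))"
          unfolding C_def sum_distrib_right by (intro mult_left_mono) auto
        moreover have "\<dots> = C * \<epsilon>" using elim by (simp add: powr_minus)
        ultimately show "dist (r powr (- a) * (\<Sum>i\<le>k. c i * F (y + ((1/2) ^ i * r) *\<^sub>R n))) (f a n) < e"
          using \<open>C * \<epsilon> < e\<close> by (simp add: dist_real_def abs_mult)
      qed
    qed
  qed
  then show ?thesis by (rule that)
qed

text \<open>At a fixed small radius the approximation samples F only on spheres inside the punctured
  ball, so it is continuous in the direction, and a uniform limit keeps continuity.\<close>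

lemma expansion_coeff_continuous:
  assumes exp: "has_expansion_at y F A f" and F: "continuous_on (cball y d - {y}) F" and d: "d > 0"
  shows "continuous_on (sphere 0 1) (f a)"
proof (cases "a \<in> A")
  case False
  then have "\<forall>n\<in>sphere 0 1. f a n = 0" using exp by (auto simp: has_expansion_at_def)
  then show ?thesis by (subst continuous_on_cong[OF refl, of _ _ "\<lambda>_. 0"]) auto
next
  case True
  from expansion_coeff_limit[OF exp this] obtain c :: "nat \<Rightarrow> real" and k where
    lim: "uniform_limit (sphere 0 1) (\<lambda>r n. r powr (- a) * (\<Sum>i\<le>k. c i * F (y + ((1/2) ^ i * r) *\<^sub>R n))) (f a) (at_right 0)"
    by blast
  have "\<forall>\<^sub>F r in at_right (0::real). 0 < r \<and> r < d"
    using d by (auto simp: eventually_at_right_field)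
  then have ev: "\<forall>\<^sub>F r in at_right 0. \<forall>i::nat. 0 < (1/2) ^ i * r \<and> (1/2) ^ i * r < d"
    by (rule eventually_at_right_scaled)
  have "\<forall>\<^sub>F r in at_right 0. continuous_on (sphere 0 1) (\<lambda>n. r powr (- a) * (\<Sum>i\<le>k. c i * F (y + ((1/2) ^ i * r) *\<^sub>R n)))"
    using ev
  proof eventually_elim
    case (elim r)
    have "continuous_on (sphere 0 1) (\<lambda>n. F (y + ((1/2) ^ i * r) *\<^sub>R n))" for i
    proof (rule continuous_on_compose2[OF F])
      have "((1/2) ^ i * r) *\<^sub>R n \<noteq> 0 \<and> norm (((1/2) ^ i * r) *\<^sub>R n) \<le> d" if "norm n = 1" for n :: point
        using that elim[rule_format, of i] by auto
      then show "(\<lambda>n. y + ((1/2) ^ i * r) *\<^sub>R n) ` sphere 0 1 \<subseteq> cball y d - {y}"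
        by (auto simp: dist_norm norm_minus_commute)
    qed (intro continuous_intros)
    then show ?case by (intro continuous_intros)
  qed
  then show ?thesis
    by (rule uniform_limit_theorem[OF _ lim]) simp
qed

lemma expansion_coeff_bounded:
  assumes "has_expansion_at y F A f" "continuous_on (cball y d - {y}) F" "d > 0"
  shows "bounded (f a ` sphere 0 1)"
  by (intro compact_imp_bounded compact_continuous_image expansion_coeff_continuous[OF assms]) simp

lemma has_expansion_at_linear:
  assumes F: "has_expansion_at y F A f" and G: "has_expansion_at y G B g"
  shows "has_expansion_at y (\<lambda>x. \<alpha> * F x + \<beta> * G x) (A \<union> B) (\<lambda>a n. \<alpha> * f a n + \<beta> * g a n)"
  unfolding has_expansion_at_def
proof (intro conjI allI impI ballI)
  fix c
  have fin: "finite {a \<in> A. a \<le> c}" "finite {a \<in> B. a \<le> c}" for c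
    using F G by (auto simp: has_expansion_at_def)
  moreover have "{a \<in> A \<union> B. a \<le> c} = {a \<in> A. a \<le> c} \<union> {a \<in> B. a \<le> c}" for c by blast
  ultimately show fin2: "finite {a \<in> A \<union> B. a \<le> c}" for c by simp
  fix N :: nat
  let ?S = "\<lambda>A f x. \<Sum>a\<in>{a \<in> A. a \<le> real N}. norm (x - y) powr a * f a (sgn (x - y))"
  have "(\<lambda>x. \<alpha> * (F x - ?S A f x) + \<beta> * (G x - ?S B g x)) \<in> o[at y](\<lambda>x. norm (x - y) ^ N)"
    using F G by (intro sum_in_smallo landau_o.small.cmult_in_iff'[THEN iffD2]) (auto simp: has_expansion_at_def)
  moreover have "\<forall>\<^sub>F x in at y. \<alpha> * (F x - ?S A f x) + \<beta> * (G x - ?S B g x)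
      = \<alpha> * F x + \<beta> * G x - ?S (A \<union> B) (\<lambda>a n. \<alpha> * f a n + \<beta> * g a n) x"
  proof (rule eventually_at_filter[THEN iffD2], intro always_eventually allI impI)
    fix x assume "x \<noteq> y"
    then have n: "sgn (x - y) \<in> sphere 0 1" by (simp add: norm_sgn)
    \<comment> \<open>Coefficients vanish off their own exponent set, so both sums may be extended
      to the union.\<close>
    have "?S A f x = ?S (A \<union> B) f x"
      using F n fin2[of N] by (intro sum.mono_neutral_left) (auto simp: has_expansion_at_def)
    moreover have "?S B g x = ?S (A \<union> B) g x"
      using G n fin2[of N] by (intro sum.mono_neutral_left) (auto simp: has_expansion_at_def)
    ultimately show "\<alpha> * (F x - ?S A f x) + \<beta> * (G x - ?S B g x)
      = \<alpha> * F x + \<beta> * G x - ?S (A \<union> B) (\<lambda>a n. \<alpha> * f a n + \<beta> * g a n) x"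
      by (simp add: sum_distrib_left algebra_simps sum.distrib)
  qed
  ultimately show "(\<lambda>x. \<alpha> * F x + \<beta> * G x - ?S (A \<union> B) (\<lambda>a n. \<alpha> * f a n + \<beta> * g a n) x) \<in> o[at y](\<lambda>x. norm (x - y) ^ N)"
    by (rule landau_o.small.in_cong[THEN iffD1, rotated])
next
  fix a n assume "a \<notin> A \<union> B" "n \<in> sphere (0::point) 1"
  then show "\<alpha> * f a n + \<beta> * g a n = 0"
    using F G by (simp add: has_expansion_at_def)
qed

text \<open>The difference of the two expansions is an expansion of the zero function, so its
  interpolation limits are limits of zero.\<close>

lemma expansion_unique:
  assumes F: "has_expansion_at y F A f" and G: "has_expansion_at y F B g" and n: "n \<in> sphere 0 1"
  shows "f a n = g a n"
proof (cases "a \<in> A \<union> B")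
  case False
  then show ?thesis using assms by (simp add: has_expansion_at_def)
next
  case True
  have "has_expansion_at y (\<lambda>x. 1 * F x + (-1) * F x) (A \<union> B) (\<lambda>a n. 1 * f a n + (-1) * g a n)"
    by (rule has_expansion_at_linear[OF F G])
  from expansion_coeff_limit[OF this True] obtain c :: "nat \<Rightarrow> real" and k where
    "uniform_limit (sphere 0 1) (\<lambda>r n. 0) (\<lambda>n. f a n - g a n) (at_right (0::real))"
    by auto
  from tendsto_uniform_limitI[OF this n] show ?thesis by (simp add: tendsto_const_iff)
qed

text \<open>The interpolating combination of a bounded function stays bounded, while its factor
  \<open>r powr (- a)\<close> tends to 0.\<close>

lemma expansion_coeff_neg_exponent:
  assumes F: "has_expansion_at y F A f" and n: "n \<in> sphere 0 1" and a: "a < 0"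
    and bd: "\<forall>\<^sub>F x in at y. \<bar>F x\<bar> \<le> M"
  shows "f a n = 0"
proof (cases "a \<in> A")
  case False
  then show ?thesis using assms by (simp add: has_expansion_at_def)
next
  case True
  from expansion_coeff_limit[OF F True] obtain c :: "nat \<Rightarrow> real" and k where
    lim: "uniform_limit (sphere 0 1) (\<lambda>r n. r powr (- a) * (\<Sum>i\<le>k. c i * F (y + ((1/2) ^ i * r) *\<^sub>R n))) (f a) (at_right 0)"
    by blast
  obtain d where "d > 0" and d: "\<And>x. x \<noteq> y \<Longrightarrow> dist x y < d \<Longrightarrow> \<bar>F x\<bar> \<le> M"
    using bd unfolding eventually_at by blast
  have "\<forall>\<^sub>F r in at_right (0::real). 0 < r \<and> r < d"
    using \<open>d > 0\<close> by (auto simp: eventually_at_right_field)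
  then have ev: "\<forall>\<^sub>F r in at_right 0. \<forall>i::nat. 0 < (1/2) ^ i * r \<and> (1/2) ^ i * r < d"
    by (rule eventually_at_right_scaled)
  have "((\<lambda>r. r powr (- a) * (\<Sum>i\<le>k. c i * F (y + ((1/2) ^ i * r) *\<^sub>R n))) \<longlongrightarrow> 0) (at_right 0)"
  proof (rule Lim_null_comparison)
    show "\<forall>\<^sub>F r in at_right 0. norm (r powr (- a) * (\<Sum>i\<le>k. c i * F (y + ((1/2) ^ i * r) *\<^sub>R n)))
        \<le> r powr (- a) * (\<Sum>i\<le>k. \<bar>c i\<bar> * M)"
      using ev
    proof eventually_elim
      case (elim r)
      have "\<bar>F (y + ((1/2) ^ i * r) *\<^sub>R n)\<bar> \<le> M" for i
      proof (rule d)
        have "n \<noteq> 0" using n by auto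
        then show "y + ((1/2) ^ i * r) *\<^sub>R n \<noteq> y" using elim[rule_format, of i] by auto
        have "dist (y + ((1/2) ^ i * r) *\<^sub>R n) y = \<bar>(1/2) ^ i * r\<bar>" using n by (simp add: dist_norm)
        then show "dist (y + ((1/2) ^ i * r) *\<^sub>R n) y < d" using elim[rule_format, of i] by linarith
      qed
      then have "\<bar>\<Sum>i\<le>k. c i * F (y + ((1/2) ^ i * r) *\<^sub>R n)\<bar> \<le> (\<Sum>i\<le>k. \<bar>c i\<bar> * M)"
        by (intro order_trans[OF sum_abs] sum_mono) (auto simp: abs_mult intro!: mult_left_mono)
      then show ?case by (auto simp: abs_mult intro!: mult_left_mono)
    qed
    have "((\<lambda>r. r powr (- a)) \<longlongrightarrow> 0 powr (- a)) (at_right 0)"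
      by (intro tendsto_powr2 tendsto_const) (use a in \<open>auto intro: eventually_mono[OF eventually_at_right_less]\<close>)
    then have "((\<lambda>r. r powr (- a)) \<longlongrightarrow> 0) (at_right 0)"
      by simp
    then show "((\<lambda>r. r powr (- a) * (\<Sum>i\<le>k. \<bar>c i\<bar> * M)) \<longlongrightarrow> 0) (at_right 0)"
      by (rule tendsto_mult_left_zero)
  qed
  then show ?thesis
    using tendsto_unique[OF _ tendsto_uniform_limitI[OF lim n]] by simp
qed

text \<open>The chosen coefficients come with an exponent set of their own, possibly different from
  the given one; \<open>expansion_unique\<close> is what relates the two.\<close>

lemma coeff_at_expansion:
  assumes "has_expansion_at y F A f"
  shows "\<exists>A. has_expansion_at y F A (coeff_at y F)"
  unfolding coeff_at_def by (rule someI_ex[where P = "\<lambda>f. \<exists>A. has_expansion_at y F A f"]) (use assms in blast)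

section \<open>Products of expansions\<close>

lemma bounded_realE:
  fixes f :: "'a \<Rightarrow> real"
  assumes "bounded (f ` S)"
  obtains K where "\<And>x. x \<in> S \<Longrightarrow> \<bar>f x\<bar> \<le> K"
  using assms by (metis bounded_iff imageI real_norm_def)

lemma bigo_powr_bounded:
  assumes "bounded (f ` sphere 0 1)" "a \<le> b"
  shows "(\<lambda>x. norm (x - y) powr b * f (sgn (x - y)) :: real) \<in> O[at y](\<lambda>x. norm (x - y :: point) powr a)"
proof -
  obtain K where K: "\<And>n. n \<in> sphere 0 1 \<Longrightarrow> \<bar>f n\<bar> \<le> K"
    using bounded_realE[OF assms(1)] by blast
  have "\<forall>\<^sub>F x in at y. x \<noteq> y \<and> dist x y < 1"
    by (auto simp: eventually_at intro!: exI[of _ 1])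
  then have "\<forall>\<^sub>F x in at y. norm (norm (x - y) powr b * f (sgn (x - y))) \<le> K * norm (norm (x - y) powr a)"
  proof eventually_elim
    case (elim x)
    have "norm (x - y) powr b \<le> norm (x - y) powr a"
      using elim assms(2) by (intro powr_mono') (auto simp: dist_norm)
    moreover have "\<bar>f (sgn (x - y))\<bar> \<le> K"
      using elim by (intro K) (simp add: norm_sgn)
    ultimately have "\<bar>f (sgn (x - y))\<bar> * norm (x - y) powr b \<le> K * norm (x - y) powr a"
      by (intro mult_mono) auto
    then show ?case by (simp add: abs_mult mult.commute)
  qed
  then show ?thesis by (rule bigoI)
qed

lemma powr_smallo_powr:
  assumes "a < b"
  shows "(\<lambda>x. norm (x - y) powr b) \<in> o[at (y::point)](\<lambda>x. norm (x - y) powr a)"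
proof (rule smalloI_tendsto)
  have "((\<lambda>x. norm (x - y) powr (b - a)) \<longlongrightarrow> norm (y - y) powr (b - a)) (at y)"
    by (intro tendsto_powr2 tendsto_intros) (use assms in auto)
  then have "((\<lambda>x. norm (x - y) powr (b - a)) \<longlongrightarrow> 0) (at y)" by simp
  then show "((\<lambda>x. norm (x - y) powr b / norm (x - y) powr a) \<longlongrightarrow> 0) (at y)"
    by (simp add: powr_diff)
  show "\<forall>\<^sub>F x in at y. norm (x - y) powr a \<noteq> 0"
    by (auto simp: eventually_at intro!: exI[of _ 1])
qed

lemma powr_power_at: "\<forall>\<^sub>F x in at (y::point). norm (x - y) powr real N = norm (x - y) ^ N"
  by (auto simp: eventually_at powr_realpow intro!: exI[of _ 1])

text \<open>Remainders are measured by natural powers and terms by \<open>powr\<close>. The two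
  agree off \<open>y\<close>, the only points that \<open>at y\<close> sees; at \<open>y\<close>
  itself they differ for \<open>N = 0\<close>, as \<open>0 powr 0 = 0\<close>.\<close>

lemma smallo_power_iff:
  "f \<in> o[at (y::point)](\<lambda>x. norm (x - y) ^ N) \<longleftrightarrow> f \<in> o[at y](\<lambda>x. norm (x - y) powr real N)"
  by (rule landau_o.small.cong_ex[OF _ eventually_mono[OF powr_power_at[of y N]]]) auto

lemma bigo_powr_smallo:
  assumes "bounded (f ` sphere 0 1)" "real N < b"
  shows "(\<lambda>x. norm (x - y) powr b * f (sgn (x - y)) :: real) \<in> o[at y](\<lambda>x. norm (x - y :: point) ^ N)"
  unfolding smallo_power_iff
  by (rule landau_o.big_small_trans[OF bigo_powr_bounded[OF assms(1) order_refl] powr_smallo_powr[OF assms(2)]])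

lemma expansion_exponents_bounded_below:
  assumes "has_expansion_at y F A f"
  obtains \<alpha> where "\<alpha> \<le> 0" "\<And>a. a \<in> A \<Longrightarrow> \<alpha> \<le> a"
proof
  \<comment> \<open>Inserting 0 guarantees a minimum and makes the lower bound nonpositive, so that
    a remainder of order o(1) can be absorbed in \<open>O\<close> of that power.\<close>
  have fin: "finite (insert 0 {a \<in> A. a \<le> 0})" using assms by (simp add: has_expansion_at_def)
  show "Min (insert 0 {a \<in> A. a \<le> 0}) \<le> 0" using fin by (intro Min_le) auto
  show "Min (insert 0 {a \<in> A. a \<le> 0}) \<le> a" if "a \<in> A" for a
  proof (cases "a \<le> 0")
    case True
    then show ?thesis using fin that by (intro Min_le) auto
  next
    case False
    then show ?thesis using fin by (intro order_trans[OF Min_le[of _ 0]]) auto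
  qed
qed

lemma expansion_partial_sum_bigo:
  assumes "\<And>a. bounded (f a ` sphere 0 1)" "\<And>a. a \<in> S \<Longrightarrow> \<alpha> \<le> a"
  shows "(\<lambda>x. \<Sum>a\<in>S. norm (x - y) powr a * f a (sgn (x - y)) :: real) \<in> O[at y](\<lambda>x. norm (x - y :: point) powr \<alpha>)"
  by (intro big_sum_in_bigo bigo_powr_bounded assms)

lemma expansion_bigo:
  assumes F: "has_expansion_at y F A f" and bd: "\<And>a. bounded (f a ` sphere 0 1)"
    and \<alpha>: "\<alpha> \<le> 0" "\<And>a. a \<in> A \<Longrightarrow> \<alpha> \<le> a"
  shows "F \<in> O[at y](\<lambda>x. norm (x - y) powr \<alpha>)"
proof -
  let ?S = "\<lambda>x. \<Sum>a\<in>{a \<in> A. a \<le> real 0}. norm (x - y) powr a * f a (sgn (x - y))"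
  have "(\<lambda>x. F x - ?S x) \<in> o[at y](\<lambda>x. norm (x - y) powr real 0)"
    using F unfolding has_expansion_at_def smallo_power_iff by blast
  moreover have "(\<lambda>x. norm (x - y) powr real 0) \<in> O[at y](\<lambda>x. norm (x - y) powr \<alpha>)"
    using bigo_powr_bounded[of "\<lambda>_. 1" \<alpha> "real 0" y] \<alpha> by (simp add: image_constant_conv)
  ultimately have "(\<lambda>x. F x - ?S x) \<in> O[at y](\<lambda>x. norm (x - y) powr \<alpha>)"
    by (meson landau_o.small_imp_big landau_o.big_trans)
  moreover have "?S \<in> O[at y](\<lambda>x. norm (x - y) powr \<alpha>)"
    by (intro expansion_partial_sum_bigo bd) (use \<alpha> in auto)
  ultimately have "(\<lambda>x. (F x - ?S x) + ?S x) \<in> O[at y](\<lambda>x. norm (x - y) powr \<alpha>)"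
    by (rule sum_in_bigo)
  then show ?thesis by simp
qed

text \<open>Cauchy product of the expansions; each exponent sum arises from finitely many pairs
  because exponents are bounded below. With truncations \<open>FM\<close> and \<open>GM\<close>, the
  difference of FG and FM GM is (F - FM) G + (G - GM) FM. The terms of FM GM are regrouped by
  exponent sum, those above \<open>N\<close> being negligible.\<close>

lemma has_expansion_at_mult:
  assumes F: "has_expansion_at y F A f" and G: "has_expansion_at y G B g"
    and fb: "\<And>a. bounded (f a ` sphere 0 1)" and gb: "\<And>a. bounded (g a ` sphere 0 1)"
  shows "\<exists>C h. has_expansion_at y (\<lambda>x. F x * G x) C h"
proof -
  obtain \<alpha> where \<alpha>: "\<alpha> \<le> 0" "\<And>a. a \<in> A \<Longrightarrow> \<alpha> \<le> a"
    using expansion_exponents_bounded_below[OF F] by blast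
  obtain \<beta> where \<beta>: "\<beta> \<le> 0" "\<And>a. a \<in> B \<Longrightarrow> \<beta> \<le> a"
    using expansion_exponents_bounded_below[OF G] by blast
  define C where "C = (\<lambda>(a, b). a + b) ` (A \<times> B)"
  define h where "h c n = (\<Sum>(a, b)\<in>{(a, b). a \<in> A \<and> b \<in> B \<and> a + b = c}. f a n * g b n)" for c n
  have finA: "finite {a \<in> A. a \<le> c}" and finB: "finite {b \<in> B. b \<le> c}" for c
    using F G by (auto simp: has_expansion_at_def)
  have fin: "finite {(a, b). a \<in> A \<and> b \<in> B \<and> a + b \<le> c}" for c
  proof (rule finite_subset)
    show "{(a, b). a \<in> A \<and> b \<in> B \<and> a + b \<le> c} \<subseteq> {a \<in> A. a \<le> c - \<beta>} \<times> {b \<in> B. b \<le> c - \<alpha>}"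
      using \<alpha> \<beta> by force
  qed (use finA finB in auto)
  have "has_expansion_at y (\<lambda>x. F x * G x) C h"
    unfolding has_expansion_at_def
  proof (intro conjI allI impI ballI)
    fix c
    have "{c' \<in> C. c' \<le> c} = (\<lambda>(a, b). a + b) ` {(a, b). a \<in> A \<and> b \<in> B \<and> a + b \<le> c}"
      by (auto simp: C_def)
    then show "finite {c' \<in> C. c' \<le> c}" using fin[of c] by simp
  next
    fix c n assume "c \<notin> C" "n \<in> sphere (0::point) 1"
    then have "{(a, b). a \<in> A \<and> b \<in> B \<and> a + b = c} = {}" by (auto simp: C_def)
    then show "h c n = 0" unfolding h_def by (simp only: sum.empty)
  next
    fix N :: nat
    define r where "r x = norm (x - y)" for x
    define n where "n x = sgn (x - y)" for x
    \<comment> \<open>Each truncation error is multiplied by a factor that may grow like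
      \<open>r powr \<alpha>\<close> or \<open>r powr \<beta>\<close>; this order compensates for
      both.\<close>
    obtain M :: nat where M: "real N - \<alpha> - \<beta> \<le> real M" using real_arch_simple by blast
    define S where "S = {a \<in> A. a \<le> real M}"
    define T where "T = {b \<in> B. b \<le> real M}"
    define FM where "FM x = (\<Sum>a\<in>S. r x powr a * f a (n x))" for x
    define GM where "GM x = (\<Sum>b\<in>T. r x powr b * g b (n x))" for x
    have FM: "(\<lambda>x. F x - FM x) \<in> o[at y](\<lambda>x. r x powr real M)"
      using F unfolding has_expansion_at_def smallo_power_iff FM_def S_def r_def n_def by blast
    have GM: "(\<lambda>x. G x - GM x) \<in> o[at y](\<lambda>x. r x powr real M)"
      using G unfolding has_expansion_at_def smallo_power_iff GM_def T_def r_def n_def by blast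
    have low: "(\<lambda>x. r x powr real M * r x powr \<gamma>) \<in> O[at y](\<lambda>x. r x ^ N)" if "\<gamma> \<ge> min \<alpha> \<beta>" for \<gamma>
    proof -
      have "real N \<le> real M + \<gamma>" using M that \<alpha>(1) \<beta>(1) by linarith
      then have "(\<lambda>x. r x powr (real M + \<gamma>)) \<in> O[at y](\<lambda>x. r x powr real N)"
        using bigo_powr_bounded[of "\<lambda>_. 1" "real N" "real M + \<gamma>" y] by (simp add: image_constant_conv r_def)
      then show ?thesis
        using powr_power_at[of y N] by (auto simp: powr_add r_def elim!: landau_o.big.cong_ex[THEN iffD1, rotated 2])
    qed
    have "(\<lambda>x. (F x - FM x) * G x) \<in> o[at y](\<lambda>x. r x powr real M * r x powr \<beta>)"
      using FM expansion_bigo[OF G gb \<beta>] unfolding r_def by (rule landau_o.small_big_mult)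
    then have 1: "(\<lambda>x. (F x - FM x) * G x) \<in> o[at y](\<lambda>x. r x ^ N)"
      by (rule landau_o.small_big_trans[OF _ low]) simp
    have "FM \<in> O[at y](\<lambda>x. r x powr \<alpha>)"
      unfolding FM_def r_def n_def by (intro expansion_partial_sum_bigo fb \<alpha>) (auto simp: S_def)
    then have "(\<lambda>x. (G x - GM x) * FM x) \<in> o[at y](\<lambda>x. r x powr real M * r x powr \<alpha>)"
      by (rule landau_o.small_big_mult[OF GM])
    then have 2: "(\<lambda>x. (G x - GM x) * FM x) \<in> o[at y](\<lambda>x. r x ^ N)"
      by (rule landau_o.small_big_trans[OF _ low]) simp
    let ?t = "\<lambda>x (a, b). r x powr (a + b) * (f a (n x) * g b (n x))"
    let ?Q = "{(a, b). a \<in> A \<and> b \<in> B \<and> a + b \<le> real N}"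
    have fST: "finite S" "finite T" using finA finB by (auto simp: S_def T_def)
    \<comment> \<open>If \<open>a + b \<le> N\<close>, the lower bound on one exponent bounds the
      other by \<open>M\<close>, so truncation loses no relevant pair.\<close>
    have Q: "?Q \<subseteq> S \<times> T"
    proof clarify
      fix a b assume "a \<in> A" "b \<in> B" "a + b \<le> real N"
      then show "a \<in> S \<and> b \<in> T" using \<alpha>(2)[of a] \<beta>(2)[of b] M \<alpha>(1) \<beta>(1) by (auto simp: S_def T_def)
    qed
    have prod: "FM x * GM x = (\<Sum>p\<in>S \<times> T. ?t x p)" for x
      unfolding FM_def GM_def sum_product sum.cartesian_product
      by (intro sum.cong) (auto simp: powr_add)
    have "(\<Sum>p\<in>S \<times> T. ?t x p) = (\<Sum>p\<in>S \<times> T - ?Q. ?t x p) + (\<Sum>p\<in>?Q. ?t x p)" for x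
      using fST Q by (intro sum.subset_diff) auto
    moreover have "(\<Sum>p\<in>?Q. ?t x p) = (\<Sum>c\<in>{c \<in> C. c \<le> real N}. r x powr c * h c (n x))" for x
    proof -
      have C: "{c \<in> C. c \<le> real N} = (\<lambda>(a, b). a + b) ` ?Q" by (auto simp: C_def)
      have "(\<Sum>p\<in>?Q. ?t x p) = (\<Sum>c\<in>{c \<in> C. c \<le> real N}. \<Sum>p\<in>{p \<in> ?Q. (\<lambda>(a, b). a + b) p = c}. ?t x p)"
        unfolding C using fin[of "real N"] by (rule sum.image_gen)
      also have "\<dots> = (\<Sum>c\<in>{c \<in> C. c \<le> real N}. r x powr c * h c (n x))"
      proof (rule sum.cong[OF refl])
        fix c assume c: "c \<in> {c \<in> C. c \<le> real N}"
        have "(\<Sum>p\<in>{p \<in> ?Q. (\<lambda>(a, b). a + b) p = c}. ?t x p)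
            = (\<Sum>(a, b)\<in>{(a, b). a \<in> A \<and> b \<in> B \<and> a + b = c}. r x powr c * (f a (n x) * g b (n x)))"
          using c by (intro sum.cong) auto
        then show "(\<Sum>p\<in>{p \<in> ?Q. (\<lambda>(a, b). a + b) p = c}. ?t x p) = r x powr c * h c (n x)"
          by (simp add: h_def sum_distrib_left split_def)
      qed
      finally show ?thesis .
    qed
    ultimately have eq: "FM x * GM x - (\<Sum>c\<in>{c \<in> C. c \<le> real N}. r x powr c * h c (n x)) = (\<Sum>p\<in>S \<times> T - ?Q. ?t x p)" for x
      using prod by simp
    \<comment> \<open>A pair in \<open>S \<times> T\<close> outside \<open>?Q\<close> has exponent
      sum above \<open>N\<close>.\<close>
    have 3: "(\<lambda>x. \<Sum>p\<in>S \<times> T - ?Q. ?t x p) \<in> o[at y](\<lambda>x. r x ^ N)"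
    proof (intro big_sum_in_smallo)
      fix p assume p: "p \<in> S \<times> T - ?Q"
      obtain a b where ab: "p = (a, b)" by (cases p)
      have "bounded ((\<lambda>n. f a n * g b n) ` sphere 0 1)"
      proof -
        obtain K L where "\<And>n. n \<in> sphere 0 1 \<Longrightarrow> \<bar>f a n\<bar> \<le> K" "\<And>n. n \<in> sphere 0 1 \<Longrightarrow> \<bar>g b n\<bar> \<le> L"
          using bounded_realE[OF fb[of a]] bounded_realE[OF gb[of b]] by metis
        then have "norm (f a n * g b n) \<le> \<bar>K\<bar> * \<bar>L\<bar>" if "n \<in> sphere 0 1" for n
          unfolding norm_mult using that by (intro mult_mono) force+
        then show ?thesis unfolding bounded_iff by blast
      qed
      then show "(\<lambda>x. ?t x p) \<in> o[at y](\<lambda>x. r x ^ N)"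
        unfolding ab prod.case r_def n_def
        by (rule bigo_powr_smallo) (use p ab in \<open>auto simp: S_def T_def\<close>)
    qed
    have "(\<lambda>x. (F x - FM x) * G x + (G x - GM x) * FM x + (\<Sum>p\<in>S \<times> T - ?Q. ?t x p)) \<in> o[at y](\<lambda>x. r x ^ N)"
      by (intro sum_in_smallo 1 2 3)
    then show "(\<lambda>x. F x * G x - (\<Sum>c\<in>{c \<in> C. c \<le> real N}. norm (x - y) powr c * h c (sgn (x - y)))) \<in> o[at y](\<lambda>x. norm (x - y) ^ N)"
      unfolding eq[symmetric] by (simp add: algebra_simps r_def n_def)
  qed
  then show ?thesis by blast
qed

section \<open>Taylor expansion and the Leibniz rule\<close>

text \<open>The power of \<open>h\<close> matching the multi-index of \<open>partials is\<close>;
  permuting the list does not change it.\<close>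

definition monomial :: "3 list \<Rightarrow> point \<Rightarrow> real" where
  "monomial is h = (\<Prod>i\<leftarrow>is. h $ i)"

lemma monomial_simps [simp]: "monomial [] h = 1" "monomial (i # is) h = h $ i * monomial is h"
  by (simp_all add: monomial_def)

lemma abs_monomial_le: "\<bar>monomial is h\<bar> \<le> norm h ^ length is"
proof (induction "is")
  case (Cons i "is")
  then show ?case
    unfolding monomial_simps abs_mult length_Cons power_Suc
    by (intro mult_mono component_le_norm_cart) auto
qed simp

lemma monomial_scaleR: "monomial is (c *\<^sub>R h) = c ^ length is * monomial is h"
  by (induction "is") simp_all

lemma monomial_sgn: "monomial is h = norm h ^ length is * monomial is (sgn h)"
proof -
  have "norm h *\<^sub>R sgn h = h" by (cases "h = 0") (simp_all add: sgn_div_norm)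
  then show ?thesis using monomial_scaleR[of "is" "norm h" "sgn h"] by simp
qed

lemma continuous_on_monomial [continuous_intros]:
  "continuous_on S f \<Longrightarrow> continuous_on S (\<lambda>x. monomial is (f x))"
  by (induction "is") (auto intro!: continuous_intros)

lemma finite_lists_of_length [simp]: "finite {is :: 'a::finite list. length is = k}"
  using finite_lists_length_eq[of "UNIV :: 'a set" k] by simp

lemma finite_lists_of_length_le [simp]: "finite {is :: 'a::finite list. length is \<le> k}"
  using finite_lists_length_le[of "UNIV :: 'a set" k] by simp

text \<open>Splitting off the head matches one further differentiation, since
  \<open>partials\<close> applies the head of the list last.\<close>

lemma sum_lists_Suc:
  fixes g :: "'a::finite list \<Rightarrow> 'b::comm_monoid_add"
  shows "(\<Sum>is\<in>{is. length is = Suc k}. g is) = (\<Sum>is\<in>{is. length is = k}. \<Sum>i\<in>UNIV. g (i # is))"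
proof -
  have "(\<Sum>is\<in>{is. length is = Suc k}. g is) = (\<Sum>(is, i)\<in>{is. length is = k} \<times> UNIV. g (i # is))"
    by (rule sum.reindex_bij_witness[of _ "\<lambda>(is, i). i # is" "\<lambda>is. (tl is, hd is)"])
      (auto simp: length_Suc_conv)
  then show ?thesis by (simp add: sum.cartesian_product)
qed

lemma continuous_on_partials: "smooth_on S \<phi> \<Longrightarrow> T \<subseteq> S \<Longrightarrow> continuous_on T (partials is \<phi>)"
  by (rule continuous_at_imp_continuous_on) (auto simp: smooth_on_def intro: differentiable_imp_continuous_within)

lemma frechet_derivative_partials:
  assumes "f differentiable (at x)"
  shows "frechet_derivative f (at x) h = (\<Sum>i\<in>UNIV. h $ i * partial i f x)"
proof -
  have lin: "linear (frechet_derivative f (at x))"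
    using assms by (simp add: linear_frechet_derivative)
  have "h = (\<Sum>i\<in>UNIV. h $ i *\<^sub>R axis i 1)"
    by (simp add: vec_eq_iff axis_def if_distrib cong: if_cong)
  then have "frechet_derivative f (at x) h = frechet_derivative f (at x) (\<Sum>i\<in>UNIV. h $ i *\<^sub>R axis i 1)"
    by simp
  then show ?thesis
    by (simp add: linear_sum[OF lin] linear_scale[OF lin] partial_def)
qed

lemma DERIV_partials_along_line:
  assumes "smooth_on UNIV \<phi>"
  shows "((\<lambda>t. partials is \<phi> (y + t *\<^sub>R h)) has_field_derivative (\<Sum>i\<in>UNIV. h $ i * partials (i # is) \<phi> (y + t *\<^sub>R h))) (at t)"
proof -
  let ?f = "partials is \<phi>" and ?g = "\<lambda>t. y + t *\<^sub>R h"
  have d: "?f differentiable (at (?g t))" using assms by (simp add: smooth_on_def)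
  have "(?f has_derivative frechet_derivative ?f (at (?g t))) (at (?g t))"
    using d frechet_derivative_works by blast
  moreover have "(?g has_derivative (\<lambda>s. s *\<^sub>R h)) (at t)"
    by (auto intro!: derivative_eq_intros)
  ultimately have "((\<lambda>t. ?f (?g t)) has_derivative (\<lambda>s. frechet_derivative ?f (at (?g t)) (s *\<^sub>R h))) (at t)"
    by (rule has_derivative_compose[rotated])
  moreover have "(\<lambda>s. frechet_derivative ?f (at (?g t)) (s *\<^sub>R h)) = (*) (\<Sum>i\<in>UNIV. h $ i * partials (i # is) \<phi> (?g t))"
    by (simp add: frechet_derivative_partials[OF d] fun_eq_iff sum_distrib_left sum_distrib_right mult_ac)
  ultimately show ?thesis
    unfolding has_field_derivative_def by simp
qed

text \<open>One-variable Taylor formula on the line through \<open>y\<close> in direction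
  \<open>h\<close>. Summing over lists counts every ordering of a multi-index, so the weight is
  \<open>1 / fact k\<close> instead of the inverse multi-index factorial.\<close>

lemma taylor_lists:
  assumes "smooth_on UNIV \<phi>"
  shows "\<exists>t. \<bar>t\<bar> \<le> 1 \<and> \<phi> (y + h) =
    (\<Sum>k<m. (\<Sum>is\<in>{is. length is = k}. partials is \<phi> y * monomial is h) / fact k) +
    (\<Sum>is\<in>{is. length is = m}. partials is \<phi> (y + t *\<^sub>R h) * monomial is h) / fact m"
proof -
  \<comment> \<open>The \<open>k\<close>-th derivative of \<phi> along the line, at parameter
    \<open>t\<close>.\<close>
  define D where "D k t = (\<Sum>is\<in>{is. length is = k}. partials is \<phi> (y + t *\<^sub>R h) * monomial is h)" for k t
  have "DERIV (D k) t :> D (Suc k) t" for k t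
    unfolding D_def sum_lists_Suc
    by (rule derivative_eq_intros DERIV_partials_along_line[OF assms] refl)+
      (simp add: sum_distrib_left sum_distrib_right mult_ac)
  then obtain t where "\<bar>t\<bar> \<le> \<bar>1\<bar>" "D 0 1 = (\<Sum>k<m. D k 0 / fact k * 1 ^ k) + D m t / fact m * 1 ^ m"
    using Maclaurin_all_le[of D "D 0" 1 m] by blast
  then show ?thesis by (auto simp: D_def)
qed

text \<open>Leibniz rule with unspecified pairs: repetitions in \<open>L\<close> stand for the
  binomial coefficients. The shape alone shows that the derivatives of a product are again
  differentiable.\<close>

lemma partials_mult:
  assumes U: "open U" and f: "smooth_on U f" and g: "smooth_on U g"
  shows "\<exists>L. \<forall>x\<in>U. partials is (\<lambda>x. f x * g x) x = (\<Sum>(js, ks)\<leftarrow>L. partials js f x * partials ks g x)"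
proof (induction "is")
  case Nil
  show ?case by (rule exI[of _ "[([], [])]"]) simp
next
  case (Cons i "is")
  then obtain L where L: "\<And>x. x \<in> U \<Longrightarrow> partials is (\<lambda>x. f x * g x) x = (\<Sum>(js, ks)\<leftarrow>L. partials js f x * partials ks g x)"
    by blast
  let ?L = "concat (map (\<lambda>(js, ks). [(i # js, ks), (js, i # ks)]) L)"
  have der: "((\<lambda>x. \<Sum>(js, ks)\<leftarrow>L. partials js f x * partials ks g x) has_derivative
     (\<lambda>h. \<Sum>(js, ks)\<leftarrow>L. frechet_derivative (partials js f) (at x) h * partials ks g x + partials js f x * frechet_derivative (partials ks g) (at x) h)) (at x)"
    if "x \<in> U" for x L
  proof (induction L)
    case (Cons p L)
    obtain js ks where p: "p = (js, ks)" by (cases p)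
    have "(partials js f has_derivative frechet_derivative (partials js f) (at x)) (at x)"
      "(partials ks g has_derivative frechet_derivative (partials ks g) (at x)) (at x)"
      using f g that by (simp_all add: smooth_on_def flip: frechet_derivative_works)
    from has_derivative_add[OF has_derivative_mult[OF this] Cons.IH]
    show ?case by (simp add: p add.commute)
  qed simp
  show ?case
  proof (intro exI[of _ ?L] ballI)
    fix x assume x: "x \<in> U"
    \<comment> \<open>Openness of \<open>U\<close> allows the formula to be differentiated instead,
      as the two functions agree near \<open>x\<close>.\<close>
    have "(partials is (\<lambda>x. f x * g x) has_derivative
     (\<lambda>h. \<Sum>(js, ks)\<leftarrow>L. frechet_derivative (partials js f) (at x) h * partials ks g x + partials js f x * frechet_derivative (partials ks g) (at x) h)) (at x)"
      using der[OF x, of L] by (rule has_derivative_transform_within_open[OF _ U x]) (simp add: L)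
    from frechet_derivative_at[OF this, symmetric]
    have "partials (i # is) (\<lambda>x. f x * g x) x = (\<Sum>(js, ks)\<leftarrow>L. partials (i # js) f x * partials ks g x + partials js f x * partials (i # ks) g x)"
      by (simp add: partial_def)
    also have "\<dots> = (\<Sum>(js, ks)\<leftarrow>?L. partials js f x * partials ks g x)"
      by (induction L) auto
    finally show "partials (i # is) (\<lambda>x. f x * g x) x = (\<Sum>(js, ks)\<leftarrow>?L. partials js f x * partials ks g x)" .
  qed
qed

lemma smooth_on_mult:
  assumes U: "open U" and f: "smooth_on U f" and g: "smooth_on U g"
  shows "smooth_on U (\<lambda>x. f x * g x)"
  unfolding smooth_on_def
proof (intro allI ballI)
  fix "is" x assume x: "x \<in> U"
  obtain L where L: "\<And>x. x \<in> U \<Longrightarrow> partials is (\<lambda>x. f x * g x) x = (\<Sum>(js, ks)\<leftarrow>L. partials js f x * partials ks g x)"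
    using partials_mult[OF assms] by blast
  have "(\<lambda>x. \<Sum>(js, ks)\<leftarrow>L. partials js f x * partials ks g x) differentiable (at x)"
    by (induction L) (use f g x in \<open>auto simp: smooth_on_def\<close>)
  then obtain D where "((\<lambda>x. \<Sum>(js, ks)\<leftarrow>L. partials js f x * partials ks g x) has_derivative D) (at x)"
    unfolding differentiable_def by blast
  then have "(partials is (\<lambda>x. f x * g x) has_derivative D) (at x)"
    by (rule has_derivative_transform_within_open[OF _ U x]) (simp add: L)
  then show "partials is (\<lambda>x. f x * g x) differentiable (at x)"
    unfolding differentiable_def by blast
qed

text \<open>The complement of the support is open, so every derivative there is that of a function
  vanishing near the point.\<close>

lemma partials_eq_0_outside:
  assumes "x \<notin> closure {x. \<phi> x \<noteq> 0}"
  shows "partials is \<phi> x = 0"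
proof -
  let ?U = "- closure {x. \<phi> x \<noteq> 0}"
  have "\<forall>x\<in>?U. partials is \<phi> x = 0"
  proof (induction "is")
    case Nil
    then show ?case using closure_subset[of "{x. \<phi> x \<noteq> 0}"] by auto
  next
    case (Cons i "is")
    show ?case
    proof
      fix x assume x: "x \<in> ?U"
      have "((\<lambda>_. 0) has_derivative (\<lambda>_. 0)) (at x)" by simp
      then have "(partials is \<phi> has_derivative (\<lambda>_. 0)) (at x)"
        by (rule has_derivative_transform_within_open[of _ _ _ _ ?U]) (use x Cons in auto)
      from frechet_derivative_at[OF this, symmetric] show "partials (i # is) \<phi> x = 0"
        by (simp add: partial_def)
    qed
  qed
  then show ?thesis using assms by blast
qed

section \<open>Boundedness of the derivatives of test functions\<close>

lemma bounded_partials: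
  assumes "\<phi> \<in> test_functions"
  shows "bounded (range (partials is \<phi>))"
proof -
  let ?K = "closure {x. \<phi> x \<noteq> 0}"
  have "compact (partials is \<phi> ` ?K)"
    using assms by (intro compact_continuous_image continuous_on_partials[of UNIV]) (auto simp: test_functions_def)
  then have "bounded (insert 0 (partials is \<phi> ` ?K))"
    by (simp add: compact_imp_bounded)
  moreover have "range (partials is \<phi>) \<subseteq> insert 0 (partials is \<phi> ` ?K)"
    using partials_eq_0_outside by blast
  ultimately show ?thesis by (rule bounded_subset)
qed

text \<open>A real \<open>SUP\<close> is known to bound its values only over a bounded range, which
  compact support provides.\<close>

lemma test_seminorm_ge:
  assumes "\<phi> \<in> test_functions"
  shows "\<bar>partials is \<phi> x\<bar> \<le> (SUP x. \<bar>partials is \<phi> x\<bar>)"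
proof (rule cSUP_upper)
  obtain K where "\<And>x. \<bar>partials is \<phi> x\<bar> \<le> K"
    using bounded_realE[OF bounded_partials[OF assms]] by (metis UNIV_I)
  then show "bdd_above (range (\<lambda>x. \<bar>partials is \<phi> x\<bar>))" by (intro bdd_aboveI2)
qed simp

section \<open>Expansions of monomials and of smooth functions\<close>

lemma has_expansion_at_monomial:
  "has_expansion_at y (\<lambda>x. monomial is (x - y)) {real (length is)} (\<lambda>a n. if a = real (length is) then monomial is n else 0)"
  unfolding has_expansion_at_def
proof (intro conjI allI impI ballI)
  fix N :: nat
  let ?k = "length is"
  have bd: "bounded (monomial is ` sphere 0 1)"
    by (intro compact_imp_bounded compact_continuous_image continuous_intros) auto
  have pw: "\<forall>\<^sub>F x in at y. monomial is (x - y) = norm (x - y) powr real ?k * monomial is (sgn (x - y))"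
    using powr_power_at[of y ?k] by eventually_elim (simp add: monomial_sgn[of "is" "_ - y"] )
  show "(\<lambda>x. monomial is (x - y) - (\<Sum>a\<in>{a \<in> {real ?k}. a \<le> real N}. norm (x - y) powr a * (if a = real ?k then monomial is (sgn (x - y)) else 0)))
      \<in> o[at y](\<lambda>x. norm (x - y) ^ N)"
  proof (cases "?k \<le> N")
    case True
    then have "{a \<in> {real ?k}. a \<le> real N} = {real ?k}" by auto
    with pw show ?thesis
      by (subst landau_o.small.in_cong[where g = "\<lambda>_. 0"]) (auto elim: eventually_mono)
  next
    case False
    then have "{a \<in> {real ?k}. a \<le> real N} = {}" by auto
    \<comment> \<open>The sum is empty here, so the monomial itself must be of smaller order than
      \<open>r ^ N\<close>.\<close>
    moreover have "(\<lambda>x. monomial is (x - y)) \<in> o[at y](\<lambda>x. norm (x - y) ^ N)"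
      using bigo_powr_smallo[OF bd, of N "real ?k" y] False by (simp add: landau_o.small.in_cong[OF pw])
    ultimately show ?thesis by (simp only: sum.empty diff_zero)
  qed
qed auto

text \<open>Taylor's formula of order \<open>Suc N\<close> leaves a remainder O(r^(N+1)), hence
  o(r^N). Exponents are reals, and \<open>nat \<lfloor>a\<rfloor>\<close> recovers the
  degree.\<close>

lemma has_expansion_at_smooth:
  assumes "smooth_on UNIV \<phi>"
  shows "has_expansion_at y \<phi> (range real)
    (\<lambda>a n. if a \<in> range real then (\<Sum>is\<in>{is. length is = nat \<lfloor>a\<rfloor>}. partials is \<phi> y * monomial is n) / fact (nat \<lfloor>a\<rfloor>) else 0)"
  unfolding has_expansion_at_def
proof (intro conjI allI impI ballI)
  fix c :: real
  have "{a \<in> range real. a \<le> c} \<subseteq> real ` {..nat \<lfloor>c\<rfloor>}" by (auto intro!: imageI) linarith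
  then show "finite {a \<in> range real. a \<le> c}" by (rule finite_subset) simp
next
  fix N :: nat
  let ?f = "\<lambda>a n. if a \<in> range real then (\<Sum>is\<in>{is. length is = nat \<lfloor>a\<rfloor>}. partials is \<phi> y * monomial is n) / fact (nat \<lfloor>a\<rfloor>) else 0"
  have S: "{a \<in> range real. a \<le> real N} = real ` {..<Suc N}" by auto
  have "\<exists>K. \<forall>x\<in>cball y 1. \<bar>partials is \<phi> x\<bar> \<le> K" for "is"
    using compact_imp_bounded[OF compact_continuous_image[OF continuous_on_partials[OF assms, of "cball y 1" "is"]]]
    by (auto simp: bounded_iff)
  then obtain K where K: "\<And>is x. x \<in> cball y 1 \<Longrightarrow> \<bar>partials is \<phi> x\<bar> \<le> K is" by metis
  define C where "C = (\<Sum>is\<in>{is. length is = Suc N}. K is)"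
  have "\<forall>\<^sub>F x in at y. x \<noteq> y \<and> dist x y < 1"
    by (auto simp: eventually_at intro!: exI[of _ 1])
  then have "\<forall>\<^sub>F x in at y. norm (\<phi> x - (\<Sum>a\<in>{a \<in> range real. a \<le> real N}. norm (x - y) powr a * ?f a (sgn (x - y))))
      \<le> C * norm (norm (x - y) powr real (Suc N))"
  proof eventually_elim
    case (elim x)
    define r where "r = norm (x - y)"
    have r: "0 < r" "r < 1" using elim by (auto simp: r_def dist_norm)
    obtain t where t: "\<bar>t\<bar> \<le> 1" "\<phi> (y + (x - y)) =
      (\<Sum>k<Suc N. (\<Sum>is\<in>{is. length is = k}. partials is \<phi> y * monomial is (x - y)) / fact k) +
      (\<Sum>is\<in>{is. length is = Suc N}. partials is \<phi> (y + t *\<^sub>R (x - y)) * monomial is (x - y)) / fact (Suc N)"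
      using taylor_lists[OF assms] by blast
    have "(\<Sum>a\<in>{a \<in> range real. a \<le> real N}. norm (x - y) powr a * ?f a (sgn (x - y)))
      = (\<Sum>k<Suc N. r ^ k * ((\<Sum>is\<in>{is. length is = k}. partials is \<phi> y * monomial is (sgn (x - y))) / fact k))"
      unfolding S using r by (subst sum.reindex) (auto simp: inj_on_def powr_realpow r_def)
    also have "\<dots> = (\<Sum>k<Suc N. (\<Sum>is\<in>{is. length is = k}. partials is \<phi> y * monomial is (x - y)) / fact k)"
      by (intro sum.cong refl) (simp add: monomial_sgn[of _ "x - y"] sum_distrib_left r_def mult_ac)
    finally have eq: "\<phi> x - (\<Sum>a\<in>{a \<in> range real. a \<le> real N}. norm (x - y) powr a * ?f a (sgn (x - y)))
      = (\<Sum>is\<in>{is. length is = Suc N}. partials is \<phi> (y + t *\<^sub>R (x - y)) * monomial is (x - y)) / fact (Suc N)"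
      using t(2) by simp
    have "\<bar>t\<bar> * r \<le> 1" using t(1) r mult_mono[of "\<bar>t\<bar>" 1 r 1] by simp
    \<comment> \<open>The intermediate point stays in the unit ball, on which the derivatives are
      bounded by \<open>K\<close>.\<close>
    then have "y + t *\<^sub>R (x - y) \<in> cball y 1" by (simp add: dist_norm r_def)
    then have "\<bar>partials is \<phi> (y + t *\<^sub>R (x - y)) * monomial is (x - y)\<bar> \<le> K is * r ^ Suc N" if "length is = Suc N" for "is"
      unfolding abs_mult using K abs_monomial_le[of "is" "x - y"] that 
      by (intro mult_mono) (auto simp: r_def intro: order_trans[OF abs_ge_zero])
    then have b1: "\<bar>\<Sum>is\<in>{is. length is = Suc N}. partials is \<phi> (y + t *\<^sub>R (x - y)) * monomial is (x - y)\<bar> \<le> C * r ^ Suc N"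
      unfolding C_def sum_distrib_right by (intro order_trans[OF sum_abs] sum_mono) auto
    have b2: "\<bar>s / fact (Suc N)\<bar> \<le> \<bar>s\<bar>" for s :: real
      using mult_left_mono[OF fact_ge_1[of "Suc N"], of "\<bar>s\<bar>"] by (simp add: abs_divide divide_le_eq del: fact_Suc)
    have b3: "norm (norm (x - y) powr real (Suc N)) = r ^ Suc N"
      using r by (simp add: powr_realpow r_def[symmetric] del: of_nat_Suc power_Suc)
    show ?case
      unfolding eq b3 unfolding real_norm_def by (rule order_trans[OF b2 b1])
  qed
  then have "(\<lambda>x. \<phi> x - (\<Sum>a\<in>{a \<in> range real. a \<le> real N}. norm (x - y) powr a * ?f a (sgn (x - y))))
      \<in> O[at y](\<lambda>x. norm (x - y) powr real (Suc N))" by (rule bigoI)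
  then show "(\<lambda>x. \<phi> x - (\<Sum>a\<in>{a \<in> range real. a \<le> real N}. norm (x - y) powr a * ?f a (sgn (x - y))))
      \<in> o[at y](\<lambda>x. norm (x - y) ^ N)"
    unfolding smallo_power_iff by (rule landau_o.big_small_trans[OF _ powr_smallo_powr]) simp
qed auto

section \<open>Local finite parts\<close>

lemma solid_angle_integral_cong:
  "(\<And>n. n \<in> sphere 0 1 \<Longrightarrow> f n = g n) \<Longrightarrow> solid_angle_integral f = solid_angle_integral g"
  by (simp add: solid_angle_integral_def norm_direction)

lemma solid_angle_integral_0 [simp]: "solid_angle_integral (\<lambda>_. 0) = 0"
  by (simp add: solid_angle_integral_def set_lebesgue_integral_def)

text \<open>Continuity supplies the integrability without which the total integral need not be
  additive.\<close>

lemma solid_angle_integral_linear: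
  assumes f: "continuous_on (sphere 0 1) f" and g: "continuous_on (sphere 0 1) g"
  shows "solid_angle_integral (\<lambda>n. \<alpha> * f n + \<beta> * g n) = \<alpha> * solid_angle_integral f + \<beta> * solid_angle_integral g"
proof -
  let ?v = "\<lambda>f q. f (vector [sin (fst q) * cos (snd q), sin (fst q) * sin (snd q), cos (fst q)] :: point) * sin (fst q) :: real"
  have "set_integrable lborel ({0..pi} \<times> {0..2*pi}) (?v f)" if "continuous_on (sphere 0 1) f" for f
    unfolding set_integrable_def
    by (intro borel_integrable_compact compact_Times continuous_intros continuous_on_compose2[OF that])
      (auto simp: norm_direction)
  note int = this[OF f] this[OF g]
  have "solid_angle_integral (\<lambda>n. \<alpha> * f n + \<beta> * g n)
      = (LINT q:{0..pi} \<times> {0..2*pi}|lborel. \<alpha> * ?v f q + \<beta> * ?v g q)"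
    by (simp add: solid_angle_integral_def split_def algebra_simps)
  also have "\<dots> = \<alpha> * solid_angle_integral f + \<beta> * solid_angle_integral g"
    using int by (subst set_integral_add) (simp_all add: solid_angle_integral_def split_def)
  finally show ?thesis .
qed

text \<open>Local counterpart of \<open>class_F\<close> with continuity in place of smoothness: what
  one singular point needs, and stable under linear combinations and products.\<close>

definition singular_at :: "point \<Rightarrow> real \<Rightarrow> (point \<Rightarrow> real) \<Rightarrow> bool" where
  "singular_at y d G \<longleftrightarrow> continuous_on (cball y d - {y}) G \<and> (\<exists>A f. has_expansion_at y G A f)"

text \<open>The share of one singular point in \<open>pf_regularised\<close>, cut off at an outer
  radius \<open>d\<close> that stays fixed as \<open>s\<close> tends to 0.\<close>

definition fp_reg :: "point \<Rightarrow> real \<Rightarrow> real \<Rightarrow> (point \<Rightarrow> real) \<Rightarrow> real \<Rightarrow> real" where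
  "fp_reg y d s0 G s = (LINT x:cball y d - cball y s|lborel. G x) + counterterm y s0 G s"

definition fp :: "point \<Rightarrow> real \<Rightarrow> real \<Rightarrow> (point \<Rightarrow> real) \<Rightarrow> real" where
  "fp y d s0 G = Lim (at_right 0) (fp_reg y d s0 G)"

lemma set_integrable_annulus:
  assumes "continuous_on (cball y d - {y}) G" "0 < s"
  shows "set_integrable lborel (cball y d - cball y s) (G :: point \<Rightarrow> real)"
proof (rule set_integrable_subset)
  have "continuous_on (cball y d - ball y s) G"
    by (rule continuous_on_subset[OF assms(1)]) (use assms(2) in auto)
  then show "set_integrable lborel (cball y d - ball y s) G"
    unfolding set_integrable_def by (intro borel_integrable_compact compact_diff) auto
qed auto

text \<open>By uniqueness the chosen coefficients may be replaced by those of any expansion, and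
  exponents with vanishing coefficient may be added or dropped. The freedom in \<open>T\<close>
  allows several functions to share one index set.\<close>

lemma counterterm_eq:
  assumes F: "has_expansion_at y F A f"
    and T: "finite T" "{a \<in> A. a < -3} \<subseteq> T" "T \<subseteq> {..<-3}"
  shows "counterterm y s0 F s = (\<Sum>a\<in>T. s powr (a + 3) / (a + 3) * solid_angle_integral (f a))
    + ln (s / s0) * solid_angle_integral (f (-3))"
proof -
  obtain B where B: "has_expansion_at y F B (coeff_at y F)"
    using coeff_at_expansion[OF F] by blast
  have eq: "coeff_at y F a n = f a n" if "n \<in> sphere 0 1" for a n
    by (rule expansion_unique[OF B F that])
  let ?X = "{a. a + 3 < 0 \<and> (\<exists>n\<in>sphere 0 1. coeff_at y F a n \<noteq> 0)}"
  have "?X \<subseteq> T"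
  proof
    fix a assume a: "a \<in> ?X"
    then obtain n where "n \<in> sphere 0 1" "f a n \<noteq> 0" using eq by auto
    then have "a \<in> A" using F unfolding has_expansion_at_def by blast
    then show "a \<in> T" using a T(2) by auto
  qed
  then have "(\<Sum>a\<in>?X. s powr (a + 3) / (a + 3) * solid_angle_integral (coeff_at y F a))
    = (\<Sum>a\<in>T. s powr (a + 3) / (a + 3) * solid_angle_integral (coeff_at y F a))"
  proof (rule sum.mono_neutral_left[OF T(1)], intro ballI)
    fix a assume "a \<in> T - ?X"
    then have "coeff_at y F a n = 0" if "n \<in> sphere 0 1" for n using T(3) that by auto
    then have "solid_angle_integral (coeff_at y F a) = solid_angle_integral (\<lambda>_. 0)"
      by (rule solid_angle_integral_cong)
    then show "s powr (a + 3) / (a + 3) * solid_angle_integral (coeff_at y F a) = 0" by simp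
  qed
  moreover have "solid_angle_integral (coeff_at y F a) = solid_angle_integral (f a)" for a
    by (rule solid_angle_integral_cong) (rule eq)
  ultimately show ?thesis by (simp add: counterterm_def)
qed

lemma singular_atI: "continuous_on (cball y d - {y}) G \<Longrightarrow> has_expansion_at y G A f \<Longrightarrow> singular_at y d G"
  unfolding singular_at_def by blast

lemma singular_atE:
  assumes "singular_at y d G"
  obtains A f where "continuous_on (cball y d - {y}) G" "has_expansion_at y G A f"
  using assms unfolding singular_at_def by blast

lemma singular_at_linear:
  assumes "singular_at y d F" "singular_at y d G"
  shows "singular_at y d (\<lambda>x. \<alpha> * F x + \<beta> * G x)"
proof -
  obtain A f where F: "continuous_on (cball y d - {y}) F" "has_expansion_at y F A f"
    using assms(1) by (rule singular_atE)
  obtain B g where G: "continuous_on (cball y d - {y}) G" "has_expansion_at y G B g"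
    using assms(2) by (rule singular_atE)
  show ?thesis
    by (rule singular_atI[OF _ has_expansion_at_linear[OF F(2) G(2)]]) (intro continuous_intros F G)
qed

lemma singular_at_mult:
  assumes "singular_at y d F" "singular_at y d G" "d > 0"
  shows "singular_at y d (\<lambda>x. F x * G x)"
proof -
  obtain A f where F: "continuous_on (cball y d - {y}) F" "has_expansion_at y F A f"
    using assms(1) by (rule singular_atE)
  obtain B g where G: "continuous_on (cball y d - {y}) G" "has_expansion_at y G B g"
    using assms(2) by (rule singular_atE)
  obtain C h where "has_expansion_at y (\<lambda>x. F x * G x) C h"
    using has_expansion_at_mult[OF F(2) G(2) expansion_coeff_bounded[OF F(2,1) assms(3)] expansion_coeff_bounded[OF G(2,1) assms(3)]]
    by blast
  then show ?thesis
    by (rule singular_atI[rotated]) (intro continuous_intros F G)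
qed

lemma singular_at_smooth:
  assumes "smooth_on UNIV \<phi>"
  shows "singular_at y d \<phi>"
  using continuous_on_partials[OF assms, of "cball y d - {y}" "[]"]
  by (intro singular_atI[OF _ has_expansion_at_smooth[OF assms]]) simp

lemma singular_at_monomial: "singular_at y d (\<lambda>x. monomial is (x - y))"
  by (rule singular_atI[OF _ has_expansion_at_monomial]) (intro continuous_intros)

lemma singular_at_0: "singular_at y d (\<lambda>_. 0)"
proof (rule singular_atI)
  show "has_expansion_at y (\<lambda>_. 0) {} (\<lambda>_ _. 0)" by (simp add: has_expansion_at_def)
qed (rule continuous_on_const)

lemma fp_reg_linear:
  assumes F: "singular_at y d F" and G: "singular_at y d G" and d: "d > 0" and s: "s > 0"
  shows "fp_reg y d s0 (\<lambda>x. \<alpha> * F x + \<beta> * G x) s = \<alpha> * fp_reg y d s0 F s + \<beta> * fp_reg y d s0 G s"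
proof -
  obtain A f where cF: "continuous_on (cball y d - {y}) F" and f: "has_expansion_at y F A f"
    using F by (rule singular_atE)
  obtain B g where cG: "continuous_on (cball y d - {y}) G" and g: "has_expansion_at y G B g"
    using G by (rule singular_atE)
  have fc: "continuous_on (sphere 0 1) (f a)" and gc: "continuous_on (sphere 0 1) (g a)" for a
    using expansion_coeff_continuous[OF f cF d] expansion_coeff_continuous[OF g cG d] by auto
  have fg: "has_expansion_at y (\<lambda>x. \<alpha> * F x + \<beta> * G x) (A \<union> B) (\<lambda>a n. \<alpha> * f a n + \<beta> * g a n)"
    by (rule has_expansion_at_linear[OF f g])
  \<comment> \<open>A common index set for the counterterms of F, G and their combination.\<close>
  define T where "T = {a \<in> A \<union> B. a < -3}"
  have "T \<subseteq> {a \<in> A \<union> B. a \<le> -3}" by (auto simp: T_def)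
  moreover have "finite {a \<in> A \<union> B. a \<le> -3}" using fg unfolding has_expansion_at_def by blast
  ultimately have T: "finite T" by (rule finite_subset)
  have "(LINT x:cball y d - cball y s|lborel. \<alpha> * F x + \<beta> * G x)
    = \<alpha> * (LINT x:cball y d - cball y s|lborel. F x) + \<beta> * (LINT x:cball y d - cball y s|lborel. G x)"
    using set_integrable_annulus[OF cF s] set_integrable_annulus[OF cG s] by (subst set_integral_add) simp_all
  moreover have "counterterm y s0 (\<lambda>x. \<alpha> * F x + \<beta> * G x) s = \<alpha> * counterterm y s0 F s + \<beta> * counterterm y s0 G s"
    by (simp add: counterterm_eq[OF fg T] counterterm_eq[OF f T] counterterm_eq[OF g T]
        T_def subset_iff solid_angle_integral_linear[OF fc gc] algebra_simps sum.distrib sum_distrib_left add_divide_distrib)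
  ultimately show ?thesis by (simp add: fp_reg_def algebra_simps)
qed

section \<open>Bounded integrands and convergence of the local finite part\<close>

lemma bounded_punctured_ball:
  fixes G :: "point \<Rightarrow> real"
  assumes G: "continuous_on (cball y d - {y}) G" and bd: "\<forall>\<^sub>F x in at y. \<bar>G x\<bar> \<le> K"
  obtains M where "M \<ge> 0" "\<And>x. x \<in> cball y d - {y} \<Longrightarrow> \<bar>G x\<bar> \<le> M"
proof -
  obtain e where "e > 0" and e: "\<And>x. x \<noteq> y \<Longrightarrow> dist x y < e \<Longrightarrow> \<bar>G x\<bar> \<le> K"
    using bd unfolding eventually_at by blast
  \<comment> \<open>Outside the small ball where the bound is assumed, what remains is
    compact.\<close>
  have "continuous_on (cball y d - ball y e) G"
    by (rule continuous_on_subset[OF G]) (use \<open>e > 0\<close> in auto)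
  then have "bounded (G ` (cball y d - ball y e))"
    by (intro compact_imp_bounded compact_continuous_image compact_diff) auto
  then obtain L where L: "\<And>x. x \<in> cball y d - ball y e \<Longrightarrow> \<bar>G x\<bar> \<le> L"
    using bounded_realE by blast
  show ?thesis
  proof (rule that)
    fix x assume x: "x \<in> cball y d - {y}"
    show "\<bar>G x\<bar> \<le> \<bar>K\<bar> + \<bar>L\<bar>"
      using e[of x] L[of x] x by (cases "dist x y < e") (auto simp: dist_commute)
  qed simp
qed

lemma set_integral_abs_le_cball:
  fixes G :: "point \<Rightarrow> real"
  assumes S: "S \<in> sets borel" "S \<subseteq> cball y d" and G: "continuous_on S G" and M: "\<And>x. x \<in> S \<Longrightarrow> \<bar>G x\<bar> \<le> M" "M \<ge> 0"
  shows "set_integrable lborel S G" "\<bar>LINT x:S|lborel. G x\<bar> \<le> M * measure lborel (cball y d)"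
proof -
  have i: "integrable lborel (\<lambda>x. indicator (cball y d) x *\<^sub>R M)"
    using emeasure_lborel_cball_finite[of y d] by (intro integrable_scaleR_left integrable_real_indicator) auto
  have le: "norm (indicator S x *\<^sub>R G x) \<le> norm (indicator (cball y d) x *\<^sub>R M)" for x
    using S(2) M by (auto simp: indicator_def)
  show int: "set_integrable lborel S G"
    unfolding set_integrable_def
  proof (rule Bochner_Integration.integrable_bound[OF i])
    show "(\<lambda>x. indicator S x *\<^sub>R G x) \<in> borel_measurable lborel"
      using borel_measurable_continuous_on_indicator[OF S(1) G] by simp
  qed (use le in auto)
  have "\<bar>LINT x:S|lborel. G x\<bar> \<le> (LINT x|lborel. indicator (cball y d) x *\<^sub>R M)"
    unfolding set_lebesgue_integral_def
  proof (rule integral_abs_bound_integral)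
    show "\<bar>indicator S x *\<^sub>R G x\<bar> \<le> indicator (cball y d) x *\<^sub>R M" for x
      using le[of x] M(2) by (simp add: indicator_def split: if_splits)
  qed (use i int in \<open>auto simp: set_integrable_def\<close>)
  then show "\<bar>LINT x:S|lborel. G x\<bar> \<le> M * measure lborel (cball y d)"
    by (simp add: mult.commute)
qed

text \<open>The missing part is a punctured ball of radius \<open>s\<close>, whose integral is at
  most \<open>M\<close> times its volume.\<close>

lemma annulus_integral_tendsto:
  fixes G :: "point \<Rightarrow> real"
  assumes G: "continuous_on (cball y d - {y}) G" and M: "\<And>x. x \<in> cball y d - {y} \<Longrightarrow> \<bar>G x\<bar> \<le> M" "M \<ge> 0" and d: "d > 0"
  shows "((\<lambda>s. LINT x:cball y d - cball y s|lborel. G x) \<longlongrightarrow> (LINT x:cball y d - {y}|lborel. G x)) (at_right 0)"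
proof (rule Lim_null[THEN iffD2], rule Lim_null_comparison)
  have "\<forall>\<^sub>F s in at_right (0::real). 0 < s \<and> s < d"
    using d by (auto simp: eventually_at_right_field)
  then show "\<forall>\<^sub>F s in at_right 0. norm ((LINT x:cball y d - cball y s|lborel. G x) - (LINT x:cball y d - {y}|lborel. G x))
      \<le> M * (unit_ball_vol 3 * s ^ 3)"
  proof eventually_elim
    case (elim s)
    have eq: "cball y d - {y} = (cball y d - cball y s) \<union> (cball y s - {y})" using elim by auto
    have sub: "cball y s - {y} \<subseteq> cball y d - {y}" using elim by auto
    have int: "set_integrable lborel (cball y s - {y}) G"
      and le: "\<bar>LINT x:cball y s - {y}|lborel. G x\<bar> \<le> M * measure lborel (cball y s)"
      by (rule set_integral_abs_le_cball[OF _ _ continuous_on_subset[OF G sub]]; use M sub in auto)+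
    have "(LINT x:cball y d - {y}|lborel. G x) = (LINT x:cball y d - cball y s|lborel. G x) + (LINT x:cball y s - {y}|lborel. G x)"
      unfolding eq using elim by (intro set_integral_Un set_integrable_annulus[OF G] int) auto
    then show ?case using elim le by (simp add: content_cball)
  qed
  have "((\<lambda>s. M * (unit_ball_vol 3 * s ^ 3)) \<longlongrightarrow> M * (unit_ball_vol 3 * 0 ^ 3)) (at_right (0::real))"
    by (intro tendsto_intros)
  then show "((\<lambda>s. M * (unit_ball_vol 3 * s ^ 3)) \<longlongrightarrow> 0) (at_right (0::real))" by simp
qed

text \<open>The factor \<open>r\<^sup>2\<close> is the radial part of the Jacobian. For
  \<open>a \<le> -3\<close> the expression is constant for \<open>s < d\<close>, the added term
  cancelling the lower end of the primitive; for larger \<open>a\<close> that end tends to 0 by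
  itself.\<close>

lemma radial_limit:
  fixes d s0 a :: real
  assumes d: "d > 0" and s0: "s0 > 0"
  shows "\<exists>L. ((\<lambda>s. integral {s..d} (\<lambda>r. r\<^sup>2 * r powr a)
      + (if a < -3 then s powr (a + 3) / (a + 3) else if a = -3 then ln (s / s0) else 0)) \<longlongrightarrow> L) (at_right 0)"
proof -
  have ev: "\<forall>\<^sub>F s in at_right (0::real). 0 < s \<and> s < d"
    using d by (auto simp: eventually_at_right_field)
  have eq: "integral {s..d} (\<lambda>r. r\<^sup>2 * r powr a) = integral {s..d} (\<lambda>r. r powr (a + 2))" if "0 < s" for s
    using that by (intro integral_cong) (simp add: powr_add powr_numeral)
  show ?thesis
  proof (cases "a = -3")
    case True
    have I: "integral {s..d} (\<lambda>r. r\<^sup>2 * r powr a) = ln d - ln s" if "0 < s" "s < d" for s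
    proof (subst eq[OF that(1)], rule integral_unique, rule fundamental_theorem_of_calculus)
      fix r assume "r \<in> {s..d}"
      then have "(ln has_real_derivative inverse r) (at r within {s..d})"
        using that by (intro DERIV_subset[OF DERIV_ln]) auto
      then show "(ln has_vector_derivative r powr (a + 2)) (at r within {s..d})"
        using True \<open>r \<in> {s..d}\<close> that by (simp add: has_real_derivative_iff_has_vector_derivative powr_minus)
    qed (use that in simp)
    have "\<forall>\<^sub>F s in at_right 0. ln d - ln s0 = integral {s..d} (\<lambda>r. r\<^sup>2 * r powr a)
      + (if a < -3 then s powr (a + 3) / (a + 3) else if a = -3 then ln (s / s0) else 0)"
      using ev by eventually_elim (use s0 in \<open>auto simp: I[unfolded True] True ln_div\<close>)
    then show ?thesis
      by (intro exI[of _ "ln d - ln s0"]) (rule Lim_transform_eventually[OF tendsto_const])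
  next
    case False
    have I: "integral {s..d} (\<lambda>r. r\<^sup>2 * r powr a) = d powr (a + 3) / (a + 3) - s powr (a + 3) / (a + 3)" if "0 < s" "s < d" for s
    proof (subst eq[OF that(1)], rule integral_unique, rule fundamental_theorem_of_calculus)
      fix r assume r: "r \<in> {s..d}"
      have "((\<lambda>r. r powr (a + 3) / (a + 3)) has_real_derivative r powr (a + 2)) (at r within {s..d})"
        using that r False by (auto intro!: derivative_eq_intros simp: add.commute)
      then show "((\<lambda>r. r powr (a + 3) / (a + 3)) has_vector_derivative r powr (a + 2)) (at r within {s..d})"
        by (simp add: has_real_derivative_iff_has_vector_derivative)
    qed (use that in simp)
    show ?thesis
    proof (cases "a < -3")
      case True
      have "\<forall>\<^sub>F s in at_right 0. d powr (a + 3) / (a + 3) = integral {s..d} (\<lambda>r. r\<^sup>2 * r powr a)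
        + (if a < -3 then s powr (a + 3) / (a + 3) else if a = -3 then ln (s / s0) else 0)"
        using ev by eventually_elim (simp add: I True)
      then show ?thesis
        by (intro exI[of _ "d powr (a + 3) / (a + 3)"]) (rule Lim_transform_eventually[OF tendsto_const])
    next
      case ge: False
      have "((\<lambda>s. s powr (a + 3)) \<longlongrightarrow> 0 powr (a + 3)) (at_right 0)"
        by (intro tendsto_powr2 tendsto_const)
          (use False ge in \<open>auto intro: eventually_mono[OF eventually_at_right_less]\<close>)
      then have "((\<lambda>s. d powr (a + 3) / (a + 3) - s powr (a + 3) / (a + 3)) \<longlongrightarrow> d powr (a + 3) / (a + 3) - 0 / (a + 3)) (at_right 0)"
        using False by (intro tendsto_intros) auto
      moreover have "\<forall>\<^sub>F s in at_right 0. d powr (a + 3) / (a + 3) - s powr (a + 3) / (a + 3) = integral {s..d} (\<lambda>r. r\<^sup>2 * r powr a)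
        + (if a < -3 then s powr (a + 3) / (a + 3) else if a = -3 then ln (s / s0) else 0)"
        using ev by eventually_elim (use False ge in \<open>simp add: I\<close>)
      ultimately show ?thesis by (blast intro: Lim_transform_eventually)
    qed
  qed
qed

lemma fp_convergent:
  assumes F: "singular_at y d F" and d: "d > 0" and s0: "s0 > 0"
  shows "(fp_reg y d s0 F \<longlongrightarrow> fp y d s0 F) (at_right 0)"
proof -
  obtain A f where cF: "continuous_on (cball y d - {y}) F" and f: "has_expansion_at y F A f"
    using F by (rule singular_atE)
  have fc: "continuous_on (sphere 0 1) (f a)" for a
    by (rule expansion_coeff_continuous[OF f cF d])
  \<comment> \<open>Exponents up to 0 suffice: the remainder is then o(1), so it is bounded near
    \<open>y\<close> and has an ordinary integral.\<close>
  define S where "S = {a \<in> A. a \<le> real 0}"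
  have S: "finite S" using f by (auto simp: S_def has_expansion_at_def)
  define P where "P x = (\<Sum>a\<in>S. norm (x - y) powr a * f a (sgn (x - y)))" for x
  define R where "R x = F x - P x" for x
  have cterm: "continuous_on (cball y d - {y}) (\<lambda>x. norm (x - y) powr a * f a (sgn (x - y)))" for a
    by (intro continuous_intros continuous_on_compose2[OF fc]) (auto simp: norm_sgn split: if_splits)
  have cP: "continuous_on (cball y d - {y}) P"
    unfolding P_def by (intro continuous_on_sum cterm)
  have cR: "continuous_on (cball y d - {y}) R"
    unfolding R_def by (intro continuous_intros cF cP)
  have "R \<in> o[at y](\<lambda>x. norm (x - y) ^ 0)"
    using f unfolding R_def P_def S_def has_expansion_at_def by blast
  from landau_o.smallD[OF this, of 1] have "\<forall>\<^sub>F x in at y. \<bar>R x\<bar> \<le> 1" by simp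
  from bounded_punctured_ball[OF cR this] obtain M where M: "M \<ge> 0" "\<And>x. x \<in> cball y d - {y} \<Longrightarrow> \<bar>R x\<bar> \<le> M"
    by blast
  \<comment> \<open>The factor of \<open>solid_angle_integral (f a)\<close> in the counterterm, zero
    for exponents above -3.\<close>
  define c where "c a s = (if a < -3 then s powr (a + 3) / (a + 3) else if a = -3 then ln (s / s0) else 0)" for a s
  have "\<forall>\<^sub>F s in at_right (0::real). 0 < s \<and> s < d"
    using d by (auto simp: eventually_at_right_field)
  then have ev: "\<forall>\<^sub>F s in at_right 0. (LINT x:cball y d - cball y s|lborel. R x)
      + (\<Sum>a\<in>S. (integral {s..d} (\<lambda>r. r\<^sup>2 * r powr a) + c a s) * solid_angle_integral (f a)) = fp_reg y d s0 F s"
  proof eventually_elim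
    case (elim s)
    let ?D = "cball y d - cball y s"
    have int: "set_integrable lborel ?D R" "\<And>a. set_integrable lborel ?D (\<lambda>x. norm (x - y) powr a * f a (sgn (x - y)))"
      using elim by (auto intro!: set_integrable_annulus cR cterm)
    have "(LINT x:?D|lborel. F x) = (LINT x:?D|lborel. R x + P x)" by (simp add: R_def)
    also have "\<dots> = (LINT x:?D|lborel. R x) + (LINT x:?D|lborel. P x)"
      using elim by (intro set_integral_add(2) int set_integrable_annulus[OF cP]) auto
    also have "(LINT x:?D|lborel. P x) = (\<Sum>a\<in>S. LINT x:?D|lborel. norm (x - y) powr a * f a (sgn (x - y)))"
      unfolding P_def set_lebesgue_integral_def scaleR_sum_right
      by (rule Bochner_Integration.integral_sum) (rule int(2)[unfolded set_integrable_def])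
    also have "\<dots> = (\<Sum>a\<in>S. integral {s..d} (\<lambda>r. r\<^sup>2 * r powr a) * solid_angle_integral (f a))"
      using elim by (intro sum.cong refl polar_integral fc continuous_on_powr continuous_intros) auto
    finally have 1: "(LINT x:?D|lborel. F x) = (LINT x:?D|lborel. R x)
      + (\<Sum>a\<in>S. integral {s..d} (\<lambda>r. r\<^sup>2 * r powr a) * solid_angle_integral (f a))" .
    have "counterterm y s0 F s = (\<Sum>a\<in>{a \<in> S. a < -3}. s powr (a + 3) / (a + 3) * solid_angle_integral (f a))
        + ln (s / s0) * solid_angle_integral (f (-3))"
      by (rule counterterm_eq[OF f finite_subset[OF _ S]]) (auto simp: S_def)
    also have "(\<Sum>a\<in>{a \<in> S. a < -3}. s powr (a + 3) / (a + 3) * solid_angle_integral (f a))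
      = (\<Sum>a\<in>S. if a < -3 then s powr (a + 3) / (a + 3) * solid_angle_integral (f a) else 0)"
      by (rule sum.inter_filter[OF S])
    \<comment> \<open>If -3 is not an exponent, its coefficient vanishes on the sphere and so does
      the logarithmic term.\<close>
    also have "ln (s / s0) * solid_angle_integral (f (-3)) = (\<Sum>a\<in>S. if a = -3 then ln (s / s0) * solid_angle_integral (f a) else 0)"
    proof (cases "-3 \<in> S")
      case False
      then have "-3 \<notin> A" by (simp add: S_def)
      then have "f (-3) n = 0" if "n \<in> sphere 0 1" for n using f that unfolding has_expansion_at_def by blast
      then have "solid_angle_integral (f (-3)) = solid_angle_integral (\<lambda>_. 0)"
        by (rule solid_angle_integral_cong)
      then show ?thesis using False by (simp add: sum.neutral)
    qed (simp add: S)
    finally have 2: "counterterm y s0 F s = (\<Sum>a\<in>S. c a s * solid_angle_integral (f a))"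
      unfolding sum.distrib[symmetric] by (auto simp: c_def intro!: sum.cong)
    show ?case
      unfolding fp_reg_def 1 2 by (simp add: sum.distrib[symmetric] algebra_simps)
  qed
  have "\<exists>L. ((\<lambda>s. integral {s..d} (\<lambda>r. r\<^sup>2 * r powr a) + c a s) \<longlongrightarrow> L) (at_right 0)" for a
    unfolding c_def by (rule radial_limit[OF d s0])
  then obtain L where L: "\<And>a. ((\<lambda>s. integral {s..d} (\<lambda>r. r\<^sup>2 * r powr a) + c a s) \<longlongrightarrow> L a) (at_right 0)"
    by metis
  have "((\<lambda>s. (LINT x:cball y d - cball y s|lborel. R x)
      + (\<Sum>a\<in>S. (integral {s..d} (\<lambda>r. r\<^sup>2 * r powr a) + c a s) * solid_angle_integral (f a)))
    \<longlongrightarrow> (LINT x:cball y d - {y}|lborel. R x) + (\<Sum>a\<in>S. L a * solid_angle_integral (f a))) (at_right 0)"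
    by (intro tendsto_add tendsto_sum tendsto_mult_right L annulus_integral_tendsto[OF cR M(2,1) d])
  from Lim_transform_eventually[OF this ev]
  have "\<exists>l. (fp_reg y d s0 F \<longlongrightarrow> l) (at_right 0)" by blast
  then show ?thesis
    unfolding fp_def using tendsto_Lim[OF trivial_limit_at_right_real] by metis
qed

lemma fp_eqI: "(fp_reg y d s0 F \<longlongrightarrow> l) (at_right 0) \<Longrightarrow> fp y d s0 F = l"
  unfolding fp_def by (rule tendsto_Lim[OF trivial_limit_at_right_real])

lemma fp_linear:
  assumes F: "singular_at y d F" and G: "singular_at y d G" and d: "d > 0" and s0: "s0 > 0"
  shows "fp y d s0 (\<lambda>x. \<alpha> * F x + \<beta> * G x) = \<alpha> * fp y d s0 F + \<beta> * fp y d s0 G"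
proof (rule fp_eqI, rule Lim_transform_eventually)
  show "((\<lambda>s. \<alpha> * fp_reg y d s0 F s + \<beta> * fp_reg y d s0 G s) \<longlongrightarrow> \<alpha> * fp y d s0 F + \<beta> * fp y d s0 G) (at_right 0)"
    by (intro tendsto_intros fp_convergent assms)
  show "\<forall>\<^sub>F s in at_right 0. \<alpha> * fp_reg y d s0 F s + \<beta> * fp_reg y d s0 G s = fp_reg y d s0 (\<lambda>x. \<alpha> * F x + \<beta> * G x) s"
    using eventually_at_right_less[of 0] by eventually_elim (simp add: fp_reg_linear[OF F G d])
qed

text \<open>Both claims go through one induction because adding a term uses
  \<open>singular_at\<close> for the sum so far.\<close>

lemma fp_sum:
  assumes J: "finite J" and G: "\<And>j. j \<in> J \<Longrightarrow> singular_at y d (G j)" and d: "d > 0" and s0: "s0 > 0"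
  shows "singular_at y d (\<lambda>x. \<Sum>j\<in>J. c j * G j x) \<and> fp y d s0 (\<lambda>x. \<Sum>j\<in>J. c j * G j x) = (\<Sum>j\<in>J. c j * fp y d s0 (G j))"
  using J G
proof (induction J)
  case empty
  have "fp y d s0 (\<lambda>x. 0 * 0 + 0 * 0) = 0 * fp y d s0 (\<lambda>_. 0) + 0 * fp y d s0 (\<lambda>_. 0)"
    by (rule fp_linear[OF singular_at_0 singular_at_0 d s0])
  then show ?case by (simp add: singular_at_0)
next
  case (insert j J)
  then have IH: "singular_at y d (\<lambda>x. \<Sum>j\<in>J. c j * G j x)" "singular_at y d (G j)"
      "fp y d s0 (\<lambda>x. \<Sum>j\<in>J. c j * G j x) = (\<Sum>j\<in>J. c j * fp y d s0 (G j))"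
    by auto
  show ?case
    using singular_at_linear[OF IH(2,1), of "c j" 1] fp_linear[OF IH(2,1) d s0, of "c j" 1] insert.hyps IH(3) by simp
qed

text \<open>A bounded function has no nonzero coefficient of negative exponent, so the powers and
  the logarithm drop out of the counterterm together and the finite part is an ordinary
  integral.\<close>

lemma fp_bounded:
  assumes G: "singular_at y d G" and M: "\<And>x. x \<in> cball y d - {y} \<Longrightarrow> \<bar>G x\<bar> \<le> M" "M \<ge> 0"
    and d: "d > 0" and s0: "s0 > 0"
  shows "\<bar>fp y d s0 G\<bar> \<le> M * measure lborel (cball y d)"
proof -
  obtain A f where cG: "continuous_on (cball y d - {y}) G" and f: "has_expansion_at y G A f"
    using G by (rule singular_atE)
  have bd: "\<forall>\<^sub>F x in at y. \<bar>G x\<bar> \<le> M"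
    unfolding eventually_at using d M(1) by (intro exI[of _ d]) (auto simp: dist_commute)
  have 0: "solid_angle_integral (f a) = 0" if "a < 0" for a
    using solid_angle_integral_cong[of "f a" "\<lambda>_. 0", OF expansion_coeff_neg_exponent[OF f _ that bd]] by simp
  have fin: "finite {a \<in> A. a < -3}"
    by (rule finite_subset[of _ "{a \<in> A. a \<le> -3}"]) (use f in \<open>auto simp: has_expansion_at_def\<close>)
  have "counterterm y s0 G s = 0" for s
    using counterterm_eq[OF f fin, of s0 s] 0 by (simp add: subset_iff sum.neutral)
  then have "((\<lambda>s. LINT x:cball y d - cball y s|lborel. G x) \<longlongrightarrow> fp y d s0 G) (at_right 0)"
    using fp_convergent[OF G d s0] by (simp add: fp_reg_def[abs_def])
  with annulus_integral_tendsto[OF cG M d] have "fp y d s0 G = (LINT x:cball y d - {y}|lborel. G x)"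
    using tendsto_unique[OF trivial_limit_at_right_real] by blast
  also have "\<bar>\<dots>\<bar> \<le> M * measure lborel (cball y d)"
    by (rule set_integral_abs_le_cball[OF _ _ cG M]) auto
  finally show ?thesis .
qed

text \<open>The lowest exponent controls F near \<open>y\<close>, compactness the rest of the ball.
  The power is a natural number because it becomes the order of a Taylor remainder.\<close>

lemma singular_at_power_bound:
  assumes F: "singular_at y d F" and d: "0 < d" "d \<le> 1"
  shows "\<exists>(p::nat) C. C \<ge> 0 \<and> (\<forall>x\<in>cball y d - {y}. \<bar>F x\<bar> * norm (x - y) ^ p \<le> C)"
proof -
  obtain A f where cF: "continuous_on (cball y d - {y}) F" and f: "has_expansion_at y F A f"
    using F by (rule singular_atE)
  obtain \<alpha> where \<alpha>: "\<alpha> \<le> 0" "\<And>a. a \<in> A \<Longrightarrow> \<alpha> \<le> a"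
    using expansion_exponents_bounded_below[OF f] by blast
  obtain p :: nat where p: "- \<alpha> \<le> real p" using real_arch_simple by blast
  obtain c where "\<forall>\<^sub>F x in at y. norm (F x) \<le> c * norm (norm (x - y) powr \<alpha>)"
    using expansion_bigo[OF f expansion_coeff_bounded[OF f cF d(1)] \<alpha>] by (rule landau_o.bigE)
  moreover have "\<forall>\<^sub>F x in at y. x \<noteq> y \<and> dist x y < 1"
    by (auto simp: eventually_at intro!: exI[of _ 1])
  ultimately have ev: "\<forall>\<^sub>F x in at y. \<bar>F x * norm (x - y) ^ p\<bar> \<le> \<bar>c\<bar>"
  proof eventually_elim
    case (elim x)
    define r where "r = norm (x - y)"
    have r: "0 < r" "r < 1" using elim by (auto simp: r_def dist_norm)
    have "\<bar>F x\<bar> \<le> c * r powr \<alpha>" using elim by (simp add: r_def)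
    also have "\<dots> \<le> \<bar>c\<bar> * r powr \<alpha>" by (intro mult_right_mono) auto
    finally have "\<bar>F x\<bar> * r ^ p \<le> \<bar>c\<bar> * r powr \<alpha> * r ^ p" using r by (intro mult_right_mono) auto
    also have "\<dots> = \<bar>c\<bar> * r powr (\<alpha> + real p)" using r by (simp add: powr_add powr_realpow)
    also have "\<dots> \<le> \<bar>c\<bar> * 1" using r p powr_mono'[of 0 "\<alpha> + real p" r] by (intro mult_left_mono) auto
    finally show ?case using r by (simp add: abs_mult r_def)
  qed
  have "continuous_on (cball y d - {y}) (\<lambda>x. F x * norm (x - y) ^ p)"
    by (intro continuous_intros cF)
  from bounded_punctured_ball[OF this ev] obtain M where
    "M \<ge> 0" "\<And>x. x \<in> cball y d - {y} \<Longrightarrow> \<bar>F x * norm (x - y) ^ p\<bar> \<le> M" by blast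
  then show ?thesis by (intro exI[of _ p] exI[of _ M]) (auto simp: abs_mult)
qed

section \<open>Estimates in terms of the seminorms of test functions\<close>

definition test_norm :: "nat \<Rightarrow> (point \<Rightarrow> real) \<Rightarrow> real" where
  "test_norm m \<phi> = (\<Sum>is\<in>{is. length is \<le> m}. SUP x. \<bar>partials is \<phi> x\<bar>)"

lemma SUP_partials_nonneg: "\<phi> \<in> test_functions \<Longrightarrow> 0 \<le> (SUP x. \<bar>partials is \<phi> x\<bar>)"
  by (rule order_trans[OF abs_ge_zero test_seminorm_ge])

lemma abs_partials_le_test_norm:
  assumes "\<phi> \<in> test_functions" "length is \<le> m"
  shows "\<bar>partials is \<phi> x\<bar> \<le> test_norm m \<phi>"
proof -
  have "(SUP x. \<bar>partials is \<phi> x\<bar>) \<le> test_norm m \<phi>"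
    unfolding test_norm_def using assms by (intro member_le_sum) (auto intro: SUP_partials_nonneg)
  then show ?thesis using test_seminorm_ge[OF assms(1)] order_trans by blast
qed

lemma test_norm_mono: "\<phi> \<in> test_functions \<Longrightarrow> m \<le> k \<Longrightarrow> test_norm m \<phi> \<le> test_norm k \<phi>"
  unfolding test_norm_def by (intro sum_mono2) (auto intro: SUP_partials_nonneg)

lemma test_norm_nonneg: "\<phi> \<in> test_functions \<Longrightarrow> 0 \<le> test_norm m \<phi>"
  unfolding test_norm_def by (intro sum_nonneg) (auto intro: SUP_partials_nonneg)

text \<open>F is fixed and only \<phi> varies: its derivatives at \<open>y\<close> enter linearly
  through the Taylor polynomial, those of order \<open>p\<close> through a pointwise bound. The
  constants therefore do not depend on the support of \<phi>.\<close>

lemma fp_mult_test_bound: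
  assumes F: "singular_at y d F" and d: "0 < d" "d \<le> 1" and s0: "s0 > 0"
  shows "\<exists>C m. C \<ge> 0 \<and> (\<forall>\<phi>\<in>test_functions. \<bar>fp y d s0 (\<lambda>x. F x * \<phi> x)\<bar> \<le> C * test_norm m \<phi>)"
proof -
  obtain p :: nat and K where K: "K \<ge> 0" "\<And>x. x \<in> cball y d - {y} \<Longrightarrow> \<bar>F x\<bar> * norm (x - y) ^ p \<le> K"
    using singular_at_power_bound[OF F d] by blast
  define J :: "3 list set" where "J = {is. length is < p}"
  have "J \<subseteq> {is. length is \<le> p}" by (auto simp: J_def)
  then have J: "finite J" using finite_lists_of_length_le finite_subset by blast
  let ?G = "\<lambda>is x. F x * monomial is (x - y)"
  have G: "singular_at y d (?G is)" for "is"
    by (rule singular_at_mult[OF F singular_at_monomial d(1)])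
  define n where "n = real (card {is::3 list. length is = p})"
  \<comment> \<open>The first summand comes from the Taylor remainder, the second from the finite
    parts of F times monomials, which do not involve \<phi>.\<close>
  define C where "C = K * n * measure lborel (cball y d) + (\<Sum>is\<in>J. \<bar>fp y d s0 (?G is)\<bar>)"
  have C: "C \<ge> 0" unfolding C_def n_def using K(1) by (intro add_nonneg_nonneg mult_nonneg_nonneg sum_nonneg) auto
  have "\<bar>fp y d s0 (\<lambda>x. F x * \<phi> x)\<bar> \<le> C * test_norm p \<phi>" if \<phi>: "\<phi> \<in> test_functions" for \<phi>
  proof -
    define N where "N = test_norm p \<phi>"
    have N: "N \<ge> 0" unfolding N_def by (rule test_norm_nonneg[OF \<phi>])
    have smooth: "smooth_on UNIV \<phi>" using \<phi> by (simp add: test_functions_def)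
    define c where "c is = partials is \<phi> y / fact (length is)" for "is"
    define Q where "Q x = (\<Sum>is\<in>J. c is * ?G is x)" for x
    define R where "R x = F x * \<phi> x - Q x" for x
    have F\<phi>: "singular_at y d (\<lambda>x. F x * \<phi> x)"
      by (rule singular_at_mult[OF F singular_at_smooth[OF smooth] d(1)])
    have Q: "singular_at y d Q" "fp y d s0 Q = (\<Sum>is\<in>J. c is * fp y d s0 (?G is))"
      using fp_sum[OF J G d(1) s0, of c] by (auto simp: Q_def[abs_def])
    \<comment> \<open>As a difference of products already treated, \<open>R\<close> has an expansion
      without one being computed.\<close>
    have R: "singular_at y d R"
      using singular_at_linear[OF F\<phi> Q(1), of 1 "-1"] by (simp add: R_def[abs_def])
    have "fp y d s0 (\<lambda>x. F x * \<phi> x) = fp y d s0 R + fp y d s0 Q"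
      using fp_linear[OF R Q(1) d(1) s0, of 1 1] by (simp add: R_def)
    moreover have "\<bar>fp y d s0 Q\<bar> \<le> (\<Sum>is\<in>J. \<bar>fp y d s0 (?G is)\<bar>) * N"
    proof -
      have "\<bar>c is\<bar> \<le> N" if "is \<in> J" for "is"
      proof -
        have "\<bar>partials is \<phi> y\<bar> / fact (length is) \<le> \<bar>partials is \<phi> y\<bar> / 1"
          by (intro divide_left_mono) auto
        also have "\<dots> \<le> N" unfolding N_def using that by (simp add: J_def abs_partials_le_test_norm[OF \<phi>])
        finally show ?thesis by (simp add: c_def)
      qed
      then show ?thesis
        unfolding Q(2) sum_distrib_right
        by (intro order_trans[OF sum_abs] sum_mono) (simp add: abs_mult mult.commute[of _ N] mult_right_mono)
    qed
    moreover have "\<bar>fp y d s0 R\<bar> \<le> K * (n * N) * measure lborel (cball y d)"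
    proof (rule fp_bounded[OF R _ _ d(1) s0])
      fix x assume x: "x \<in> cball y d - {y}"
      obtain t where t: "\<phi> (y + (x - y)) =
        (\<Sum>k<p. (\<Sum>is\<in>{is. length is = k}. partials is \<phi> y * monomial is (x - y)) / fact k) +
        (\<Sum>is\<in>{is. length is = p}. partials is \<phi> (y + t *\<^sub>R (x - y)) * monomial is (x - y)) / fact p"
        using taylor_lists[OF smooth] by blast
      define T where "T = (\<Sum>is\<in>{is. length is = p}. partials is \<phi> (y + t *\<^sub>R (x - y)) * monomial is (x - y))"
      \<comment> \<open>Grouping the lists of \<open>J\<close> by length gives the double sum of
        Taylor's formula.\<close>
      have "(\<Sum>is\<in>J. c is * monomial is (x - y))
        = (\<Sum>k<p. \<Sum>is\<in>{is \<in> J. length is = k}. c is * monomial is (x - y))"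
        using J by (intro sum.group[symmetric]) (auto simp: J_def)
      also have "\<dots> = (\<Sum>k<p. (\<Sum>is\<in>{is. length is = k}. partials is \<phi> y * monomial is (x - y)) / fact k)"
        unfolding sum_divide_distrib by (intro sum.cong) (auto simp: J_def c_def)
      finally have "\<phi> x = (\<Sum>is\<in>J. c is * monomial is (x - y)) + T / fact p"
        using t by (simp add: T_def)
      then have Rx: "R x = F x * (T / fact p)"
        by (simp add: R_def Q_def algebra_simps sum_distrib_left)
      have "\<bar>T\<bar> \<le> (\<Sum>is\<in>{is::3 list. length is = p}. N * norm (x - y) ^ p)"
        unfolding T_def
      proof (intro order_trans[OF sum_abs] sum_mono)
        fix "is" :: "3 list" assume "is \<in> {is. length is = p}"
        then show "\<bar>partials is \<phi> (y + t *\<^sub>R (x - y)) * monomial is (x - y)\<bar> \<le> N * norm (x - y) ^ p"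
          unfolding abs_mult N_def using abs_monomial_le[of "is" "x - y"]
          by (intro mult_mono abs_partials_le_test_norm[OF \<phi>] test_norm_nonneg[OF \<phi>]) auto
      qed
      then have T: "\<bar>T\<bar> \<le> n * N * norm (x - y) ^ p" by (simp add: n_def)
      have "\<bar>T\<bar> / fact p \<le> \<bar>T\<bar> / 1" by (intro divide_left_mono) auto
      then have "\<bar>R x\<bar> \<le> \<bar>F x\<bar> * (n * N * norm (x - y) ^ p)"
        unfolding Rx abs_mult using T by (intro mult_left_mono) auto
      \<comment> \<open>The power of the distance in the Taylor remainder is paired with F, where
        \<open>K\<close> bounds the product.\<close>
      also have "\<dots> = (\<bar>F x\<bar> * norm (x - y) ^ p) * (n * N)" by simp
      also have "\<dots> \<le> K * (n * N)"
        using x N by (intro mult_right_mono K(2)) (auto simp: n_def)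
      finally show "\<bar>R x\<bar> \<le> K * (n * N)" .
    qed (use K N in \<open>simp add: n_def\<close>)
    ultimately have "\<bar>fp y d s0 (\<lambda>x. F x * \<phi> x)\<bar> \<le> K * (n * N) * measure lborel (cball y d) + (\<Sum>is\<in>J. \<bar>fp y d s0 (?G is)\<bar>) * N"
      by linarith
    also have "\<dots> = C * N" by (simp add: C_def algebra_simps)
    finally show ?thesis by (simp add: N_def)
  qed
  with C show ?thesis by blast
qed

section \<open>The pseudo-function as a distribution\<close>

lemma smooth_on_subset: "smooth_on S f \<Longrightarrow> T \<subseteq> S \<Longrightarrow> smooth_on T f"
  unfolding smooth_on_def by blast

text \<open>Disjointness keeps the other singular point, where F may fail to be continuous, out of
  each ball.\<close>

lemma class_F_singular_at:
  assumes F: "F \<in> class_F y1 y2" and d: "cball y1 d \<inter> cball y2 d = {}" "d > 0"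
  shows "singular_at y1 d F" "singular_at y2 d F"
proof -
  have F': "smooth_on (UNIV - {y1, y2}) F" "\<exists>A f. has_expansion_at y1 F A f" "\<exists>A f. has_expansion_at y2 F A f"
    using F by (auto simp: class_F_def)
  have "y1 \<in> cball y1 d" "y2 \<in> cball y2 d" using d(2) by auto
  then have sub: "cball y1 d - {y1} \<subseteq> UNIV - {y1, y2}" "cball y2 d - {y2} \<subseteq> UNIV - {y1, y2}"
    using d(1) by blast+
  show "singular_at y1 d F" "singular_at y2 d F"
    using continuous_on_partials[OF F'(1) sub(1), of "[]"] continuous_on_partials[OF F'(1) sub(2), of "[]"] F'(2,3)
    by (simp_all add: singular_at_def)
qed

lemma test_function_in_class_F:
  assumes "\<phi> \<in> test_functions"
  shows "\<phi> \<in> class_F y1 y2"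
proof -
  have "smooth_on UNIV \<phi>" using assms by (simp add: test_functions_def)
  then show ?thesis
    unfolding class_F_def using smooth_on_subset[of UNIV \<phi>] has_expansion_at_smooth by blast
qed

lemma class_F_mult_test:
  assumes F: "F \<in> class_F y1 y2" and \<phi>: "\<phi> \<in> test_functions" and d: "cball y1 d \<inter> cball y2 d = {}" "d > 0"
  shows "(\<lambda>x. F x * \<phi> x) \<in> class_F y1 y2"
proof -
  have s: "smooth_on UNIV \<phi>" using \<phi> by (simp add: test_functions_def)
  have "smooth_on (UNIV - {y1, y2}) (\<lambda>x. F x * \<phi> x)"
    using F smooth_on_subset[OF s] by (intro smooth_on_mult) (auto simp: class_F_def)
  moreover have "singular_at y1 d (\<lambda>x. F x * \<phi> x)" "singular_at y2 d (\<lambda>x. F x * \<phi> x)"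
    by (intro singular_at_mult class_F_singular_at[OF F d] singular_at_smooth[OF s] d(2))+
  ultimately show ?thesis by (simp add: class_F_def singular_at_def)
qed

lemma set_integrable_mult_test:
  assumes F: "F \<in> class_F y1 y2" and \<phi>: "\<phi> \<in> test_functions" and s: "s > 0"
  shows "set_integrable lborel (UNIV - (cball y1 s \<union> cball y2 s)) (\<lambda>x. F x * \<phi> x)"
proof -
  let ?E = "UNIV - (cball y1 s \<union> cball y2 s)" and ?K = "closure {x. \<phi> x \<noteq> 0}"
  \<comment> \<open>Removing open balls from the support leaves a compact set away from both
    singular points, on which the integrand is continuous.\<close>
  let ?C = "?K \<inter> (UNIV - (ball y1 s \<union> ball y2 s))"
  have "smooth_on (UNIV - {y1, y2}) F" "smooth_on UNIV \<phi>" and K: "compact ?K"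
    using F \<phi> by (auto simp: class_F_def test_functions_def)
  moreover have "?C \<subseteq> UNIV - {y1, y2}" using s by auto
  ultimately have "continuous_on ?C F" "continuous_on ?C \<phi>"
    using continuous_on_partials[of _ _ ?C "[]"] by auto
  moreover have "compact ?C"
    by (rule compact_Int_closed[OF K]) (intro closed_Diff closed_UNIV open_Un open_ball)
  ultimately have "set_integrable lborel ?C (\<lambda>x. F x * \<phi> x)"
    unfolding set_integrable_def by (intro borel_integrable_compact continuous_intros)
  then have "set_integrable lborel (?K \<inter> ?E) (\<lambda>x. F x * \<phi> x)"
    by (rule set_integrable_subset) auto
  moreover have "indicator (?K \<inter> ?E) x *\<^sub>R (F x * \<phi> x) = indicator ?E x *\<^sub>R (F x * \<phi> x)" for x
    using closure_subset[of "{x. \<phi> x \<noteq> 0}"] by (auto simp: indicator_def)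
  ultimately show ?thesis by (simp only: set_integrable_def)
qed

text \<open>The product vanishes near infinity, which settles both conditions there.\<close>

lemma mult_test_in_Pf_domain:
  assumes \<phi>: "\<phi> \<in> test_functions"
  shows "\<phi> \<in> Pf_domain y1 y2 F"
proof -
  have "bounded (closure {x. \<phi> x \<noteq> 0})"
    using \<phi> by (simp add: test_functions_def compact_imp_bounded)
  then obtain R where R: "\<And>x. x \<in> closure {x. \<phi> x \<noteq> 0} \<Longrightarrow> norm x \<le> R"
    unfolding bounded_iff by blast
  have 0: "\<phi> x = 0" if "norm x > R" for x
    using R[of x] closure_subset[of "{x. \<phi> x \<noteq> 0}"] that by fastforce
  have "\<forall>\<^sub>F x in at_infinity. F x * \<phi> x = 0"
    unfolding eventually_at_infinity by (rule exI[of _ "R + 1"]) (simp add: 0)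
  then have "(\<lambda>x. F x * \<phi> x) \<in> o[at_infinity](\<lambda>x. norm x powr (-3))"
    by (subst landau_o.small.in_cong[where g = "\<lambda>_. 0"]) auto
  moreover have "(\<lambda>x. indicator (UNIV - cball 0 R) x *\<^sub>R (F x * \<phi> x)) = (\<lambda>_. 0)"
    by (auto simp: indicator_def 0 fun_eq_iff)
  then have "set_integrable lborel (UNIV - cball 0 R) (\<lambda>x. F x * \<phi> x)"
    by (simp only: set_integrable_def integrable_zero)
  ultimately show ?thesis
    using test_function_in_class_F[OF \<phi>] by (auto simp: Pf_domain_def)
qed

section \<open>Splitting into an outer integral and two local finite parts\<close>

lemma pf_regularised_eq:
  assumes int: "\<And>s. s > 0 \<Longrightarrow> set_integrable lborel (UNIV - (cball y1 s \<union> cball y2 s)) G"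
    and d: "cball y1 d \<inter> cball y2 d = {}" and s: "0 < s" "s < d"
  shows "pf_regularised y1 y2 s1 s2 G s
    = (LINT x:UNIV - (cball y1 d \<union> cball y2 d)|lborel. G x) + fp_reg y1 d s1 G s + fp_reg y2 d s2 G s"
proof -
  let ?O = "UNIV - (cball y1 d \<union> cball y2 d)" and ?A = "cball y1 d - cball y1 s" and ?B = "cball y2 d - cball y2 s"
  have sub: "cball y1 s \<subseteq> cball y1 d" "cball y2 s \<subseteq> cball y2 d" using s by auto
  then have eq: "UNIV - (cball y1 s \<union> cball y2 s) = ?O \<union> (?A \<union> ?B)" using d by blast
  have i: "set_integrable lborel S G" if "S \<subseteq> ?O \<union> (?A \<union> ?B)" "S \<in> sets lborel" for S
    using int[OF s(1)] that unfolding eq by (intro set_integrable_subset[of lborel "?O \<union> (?A \<union> ?B)" G S]) auto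
  have "(LINT x:?O \<union> (?A \<union> ?B)|lborel. G x) = (LINT x:?O|lborel. G x) + (LINT x:?A \<union> ?B|lborel. G x)"
    by (intro set_integral_Un i) auto
  also have "(LINT x:?A \<union> ?B|lborel. G x) = (LINT x:?A|lborel. G x) + (LINT x:?B|lborel. G x)"
    using d by (intro set_integral_Un i) auto
  finally show ?thesis by (simp add: pf_regularised_def fp_reg_def eq)
qed

lemma pf_regularised_tendsto:
  assumes int: "\<And>s. s > 0 \<Longrightarrow> set_integrable lborel (UNIV - (cball y1 s \<union> cball y2 s)) G"
    and G: "singular_at y1 d G" "singular_at y2 d G" and s: "s1 > 0" "s2 > 0"
    and d: "cball y1 d \<inter> cball y2 d = {}" "d > 0"
  shows "(pf_regularised y1 y2 s1 s2 G
    \<longlongrightarrow> (LINT x:UNIV - (cball y1 d \<union> cball y2 d)|lborel. G x) + fp y1 d s1 G + fp y2 d s2 G) (at_right 0)"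
proof (rule Lim_transform_eventually)
  let ?I = "LINT x:UNIV - (cball y1 d \<union> cball y2 d)|lborel. G x"
  show "((\<lambda>s. ?I + fp_reg y1 d s1 G s + fp_reg y2 d s2 G s) \<longlongrightarrow> ?I + fp y1 d s1 G + fp y2 d s2 G) (at_right 0)"
    by (intro tendsto_intros fp_convergent G d s)
  have "\<forall>\<^sub>F s in at_right (0::real). 0 < s \<and> s < d"
    using d(2) by (auto simp: eventually_at_right_field)
  then show "\<forall>\<^sub>F s in at_right 0. ?I + fp_reg y1 d s1 G s + fp_reg y2 d s2 G s = pf_regularised y1 y2 s1 s2 G s"
    by eventually_elim (use pf_regularised_eq[OF int d(1)] in auto)
qed

text \<open>The constant is the integral of the absolute value of F over the part of
  \<open>K\<close> outside the open balls, a compact set on which F is continuous. No derivative of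
  \<phi> is involved.\<close>

lemma outer_integral_bound:
  assumes F: "F \<in> class_F y1 y2" and K: "compact K" and d: "d > 0"
  shows "\<exists>C\<ge>0. \<forall>\<phi>\<in>test_functions. closure {x. \<phi> x \<noteq> 0} \<subseteq> K \<longrightarrow>
    \<bar>LINT x:UNIV - (cball y1 d \<union> cball y2 d)|lborel. F x * \<phi> x\<bar> \<le> C * test_norm 0 \<phi>"
proof (intro exI conjI ballI impI)
  let ?O = "UNIV - (cball y1 d \<union> cball y2 d)" and ?C = "K \<inter> (UNIV - (ball y1 d \<union> ball y2 d))"
  let ?H = "\<lambda>x. indicator ?C x *\<^sub>R \<bar>F x\<bar>"
  have "?C \<subseteq> UNIV - {y1, y2}" using d by auto
  then have "continuous_on ?C F"
    using continuous_on_partials[of _ F ?C "[]"] F by (auto simp: class_F_def)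
  moreover have "compact ?C"
    by (rule compact_Int_closed[OF K]) (intro closed_Diff closed_UNIV open_Un open_ball)
  ultimately have int: "integrable lborel ?H"
    by (intro borel_integrable_compact continuous_intros)
  show "(LINT x|lborel. ?H x) \<ge> 0" by (rule integral_nonneg_AE) auto
  fix \<phi> assume \<phi>: "\<phi> \<in> test_functions" and sub: "closure {x. \<phi> x \<noteq> 0} \<subseteq> K"
  have "\<bar>LINT x:?O|lborel. F x * \<phi> x\<bar> \<le> (LINT x|lborel. ?H x * test_norm 0 \<phi>)"
    unfolding set_lebesgue_integral_def
  proof (rule integral_abs_bound_integral)
    show "integrable lborel (\<lambda>x. indicator ?O x *\<^sub>R (F x * \<phi> x))"
      using set_integrable_mult_test[OF F \<phi> d] by (simp only: set_integrable_def)
    show "integrable lborel (\<lambda>x. ?H x * test_norm 0 \<phi>)"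
      using int by (rule integrable_mult_left)
    fix x
    show "\<bar>indicator ?O x *\<^sub>R (F x * \<phi> x)\<bar> \<le> ?H x * test_norm 0 \<phi>"
    proof (cases "x \<in> ?O \<and> \<phi> x \<noteq> 0")
      case True
      then have "x \<in> K" using sub closure_subset[of "{x. \<phi> x \<noteq> 0}"] by blast
      with True have "x \<in> ?C" by auto
      moreover have "\<bar>\<phi> x\<bar> \<le> test_norm 0 \<phi>" using abs_partials_le_test_norm[OF \<phi>, of "[]"] by simp
      ultimately show ?thesis using True by (simp add: abs_mult mult_left_mono)
    next
      case False
      then show ?thesis using test_norm_nonneg[OF \<phi>] by (auto simp: indicator_def)
    qed
  qed
  then show "\<bar>LINT x:?O|lborel. F x * \<phi> x\<bar> \<le> (LINT x|lborel. ?H x) * test_norm 0 \<phi>"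
    by simp
qed

lemma disjoint_cballs:
  fixes y1 y2 :: "'a::metric_space"
  assumes "y1 \<noteq> y2"
  obtains d where "0 < d" "d \<le> 1" "cball y1 d \<inter> cball y2 d = {}"
proof
  \<comment> \<open>A third of the distance lies safely below the half at which the closed balls
    would touch.\<close>
  let ?d = "min 1 (dist y1 y2 / 3)"
  show "0 < ?d" "?d \<le> 1" using assms by auto
  have "False" if "x \<in> cball y1 ?d" "x \<in> cball y2 ?d" for x
  proof -
    have "dist y1 x \<le> dist y1 y2 / 3" "dist y2 x \<le> dist y1 y2 / 3" using that by auto
    then show ?thesis using dist_triangle[of y1 y2 x] zero_less_dist_iff[of y1 y2] assms unfolding dist_commute[of x y2] by linarith
  qed
  then show "cball y1 ?d \<inter> cball y2 ?d = {}" by blast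
qed

text \<open>Since \<open>Pf\<close> is built from total integrals and limits, the conclusion also
  records that test functions lie in its domain and that the defining limit exists.\<close>

theorem lemma3:
  fixes y1 y2 :: point and s1 s2 :: real and F :: "point \<Rightarrow> real"
  assumes "y1 \<noteq> y2" and "s1 > 0" and "s2 > 0"
    and "F \<in> class_F y1 y2"
  shows "test_functions \<subseteq> Pf_domain y1 y2 F
    \<and> (\<forall>\<phi>\<in>test_functions. pf_exists y1 y2 s1 s2 (\<lambda>x. F x * \<phi> x))
    \<and> distribution (Pf y1 y2 s1 s2 F)"
proof (intro conjI subsetI ballI)
  note s = assms(2,3) and F = assms(4)
  obtain d where d: "0 < d" "d \<le> 1" and disj: "cball y1 d \<inter> cball y2 d = {}"
    using disjoint_cballs[OF assms(1)] by blast
  let ?O = "UNIV - (cball y1 d \<union> cball y2 d)"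
  have int: "set_integrable lborel (UNIV - (cball y1 s \<union> cball y2 s)) (\<lambda>x. F x * \<phi> x)" if "\<phi> \<in> test_functions" "s > 0" for \<phi> s
    by (rule set_integrable_mult_test[OF F that])
  have sing: "singular_at y1 d (\<lambda>x. F x * \<phi> x)" "singular_at y2 d (\<lambda>x. F x * \<phi> x)" if "\<phi> \<in> test_functions" for \<phi>
    using class_F_singular_at[OF class_F_mult_test[OF F that disj d(1)] disj d(1)] by auto
  note lim = pf_regularised_tendsto[OF _ _ _ s disj d(1)]
  note pf_integral_eq = tendsto_Lim[OF trivial_limit_at_right_real lim, folded pf_integral_def]
  show "\<phi> \<in> Pf_domain y1 y2 F" if "\<phi> \<in> test_functions" for \<phi>
    using that by (rule mult_test_in_Pf_domain)
  show "pf_exists y1 y2 s1 s2 (\<lambda>x. F x * \<phi> x)" if "\<phi> \<in> test_functions" for \<phi>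
    unfolding pf_exists_def
    using class_F_mult_test[OF F that disj d(1)] int[OF that] lim[OF int sing, OF that _ that that] by blast
  have Pf: "Pf y1 y2 s1 s2 F \<phi> = (LINT x:?O|lborel. F x * \<phi> x) + fp y1 d s1 (\<lambda>x. F x * \<phi> x) + fp y2 d s2 (\<lambda>x. F x * \<phi> x)"
    if "\<phi> \<in> test_functions" for \<phi>
    unfolding Pf_def by (intro pf_integral_eq int sing that)
  have Pf_linear: "Pf y1 y2 s1 s2 F (\<lambda>x. \<alpha> * \<phi> x + \<beta> * \<psi> x) = \<alpha> * Pf y1 y2 s1 s2 F \<phi> + \<beta> * Pf y1 y2 s1 s2 F \<psi>"
    if \<phi>\<psi>: "\<phi> \<in> test_functions" "\<psi> \<in> test_functions" for \<alpha> \<beta> \<phi> \<psi>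
  proof -
    \<comment> \<open>In this form integrability and \<open>singular_at\<close> are inherited from
      the two terms, and the linear combination need not be shown to be a test function.\<close>
    let ?G = "\<lambda>x. \<alpha> * (F x * \<phi> x) + \<beta> * (F x * \<psi> x)"
    have "pf_integral y1 y2 s1 s2 ?G = (LINT x:?O|lborel. ?G x) + fp y1 d s1 ?G + fp y2 d s2 ?G"
    proof (rule pf_integral_eq)
      show "set_integrable lborel (UNIV - (cball y1 s \<union> cball y2 s)) ?G" if "s > 0" for s
        using int[OF \<phi>\<psi>(1) that] int[OF \<phi>\<psi>(2) that] by (intro set_integral_add(1)) simp_all
    qed (intro singular_at_linear sing \<phi>\<psi>)+
    also have "(LINT x:?O|lborel. ?G x) = \<alpha> * (LINT x:?O|lborel. F x * \<phi> x) + \<beta> * (LINT x:?O|lborel. F x * \<psi> x)"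
      using int[OF \<phi>\<psi>(1) d(1)] int[OF \<phi>\<psi>(2) d(1)] by (subst set_integral_add(2)) simp_all
    finally have "pf_integral y1 y2 s1 s2 ?G = \<alpha> * Pf y1 y2 s1 s2 F \<phi> + \<beta> * Pf y1 y2 s1 s2 F \<psi>"
      unfolding Pf[OF \<phi>\<psi>(1)] Pf[OF \<phi>\<psi>(2)]
        fp_linear[OF sing(1)[OF \<phi>\<psi>(1)] sing(1)[OF \<phi>\<psi>(2)] d(1) s(1)]
        fp_linear[OF sing(2)[OF \<phi>\<psi>(1)] sing(2)[OF \<phi>\<psi>(2)] d(1) s(2)]
      by (simp add: algebra_simps)
    moreover have "?G = (\<lambda>x. F x * (\<alpha> * \<phi> x + \<beta> * \<psi> x))"
      by (simp add: fun_eq_iff algebra_simps)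
    ultimately show ?thesis by (simp add: Pf_def)
  qed
  show "distribution (Pf y1 y2 s1 s2 F)"
    unfolding distribution_def
  proof (intro conjI ballI allI impI)
    show "Pf y1 y2 s1 s2 F (\<lambda>x. \<phi> x + \<psi> x) = Pf y1 y2 s1 s2 F \<phi> + Pf y1 y2 s1 s2 F \<psi>"
      if "\<phi> \<in> test_functions" "\<psi> \<in> test_functions" for \<phi> \<psi>
      using Pf_linear[OF that, of 1 1] by simp
    show "Pf y1 y2 s1 s2 F (\<lambda>x. c * \<phi> x) = c * Pf y1 y2 s1 s2 F \<phi>" if "\<phi> \<in> test_functions" for c \<phi>
      using Pf_linear[OF that that, of c 0] by simp
    fix K :: "point set" assume K: "compact K"
    obtain C0 where C0: "C0 \<ge> 0" "\<And>\<phi>. \<phi> \<in> test_functions \<Longrightarrow> closure {x. \<phi> x \<noteq> 0} \<subseteq> K \<Longrightarrow>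
        \<bar>LINT x:?O|lborel. F x * \<phi> x\<bar> \<le> C0 * test_norm 0 \<phi>"
      using outer_integral_bound[OF F K d(1)] by blast
    obtain C1 m1 where C1: "C1 \<ge> 0" "\<And>\<phi>. \<phi> \<in> test_functions \<Longrightarrow> \<bar>fp y1 d s1 (\<lambda>x. F x * \<phi> x)\<bar> \<le> C1 * test_norm m1 \<phi>"
      using fp_mult_test_bound[OF class_F_singular_at(1)[OF F disj d(1)] d s(1)] by blast
    obtain C2 m2 where C2: "C2 \<ge> 0" "\<And>\<phi>. \<phi> \<in> test_functions \<Longrightarrow> \<bar>fp y2 d s2 (\<lambda>x. F x * \<phi> x)\<bar> \<le> C2 * test_norm m2 \<phi>"
      using fp_mult_test_bound[OF class_F_singular_at(2)[OF F disj d(1)] d s(2)] by blast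
    \<comment> \<open>The larger of the two local orders; the outer integral is bounded at order
      0.\<close>
    let ?m = "max m1 m2"
    have "\<bar>Pf y1 y2 s1 s2 F \<phi>\<bar> \<le> (C0 + C1 + C2) * test_norm ?m \<phi>"
      if \<phi>: "\<phi> \<in> test_functions" "closure {x. \<phi> x \<noteq> 0} \<subseteq> K" for \<phi>
    proof -
      have "C0 * test_norm 0 \<phi> \<le> C0 * test_norm ?m \<phi>" "C1 * test_norm m1 \<phi> \<le> C1 * test_norm ?m \<phi>"
        "C2 * test_norm m2 \<phi> \<le> C2 * test_norm ?m \<phi>"
        using C0(1) C1(1) C2(1) by (auto intro!: mult_left_mono test_norm_mono[OF \<phi>(1)])
      then show ?thesis
        using C0(2)[OF \<phi>] C1(2)[OF \<phi>(1)] C2(2)[OF \<phi>(1)] unfolding Pf[OF \<phi>(1)] distrib_right by linarith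
    qed
    then show "\<exists>C m. \<forall>\<phi>\<in>test_functions. closure {x. \<phi> x \<noteq> 0} \<subseteq> K \<longrightarrow>
        \<bar>Pf y1 y2 s1 s2 F \<phi>\<bar> \<le> C * (\<Sum>is\<in>{is. length is \<le> m}. SUP x. \<bar>partials is \<phi> x\<bar>)"
      unfolding test_norm_def by blast
  qed
qed

end
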